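(* Let $\{X_1,X_2,\dots\}$ be a random dense countable subset of $(0,1)$ satisfying the independence condition. Then it has the uniform distribution if and only if, for every Borel set $B\subset(0,1)$, $\Pr(B\cap\{X_1,X_2,\dots\}\ne\emptyset)=0$ if $\mathrm{mes}(B)=0$, and $\Pr(B\cap\{X_1,X_2,\dots\}\ne\emptyset)=1$ if $\mathrm{mes}(B)>0$, where $\mathrm{mes}$ denotes Lebesgue measure.
   Context: A random countable subset of $(0,1)$ is given by a sequence of random variables $X_1,X_2,\dots:\Omega\to(0,1)$ on a probability space, the set being $\omega\mapsto\{X_1(\omega),X_2(\omega),\dots\}$; multiplicities are ignored. It is a random dense countable subset if this set is dense in $(0,1)$ for almost every $\omega$. Two random countable sets $\{X_k\}$ and $\{Y_k\}$, possibly on different probability spaces, are identically distributed if there is a probability measure $P$ on $(0,1)^\infty\times(0,1)^\infty$ with first marginal the law of $(X_1,X_2,\dots)$ and second marginal the law of $(Y_1,Y_2,\dots)$, such that $\{x_1,x_2,\dots\}=\{y_1,y_2,\dots\}$ for $P$-a.a. $(x,y)$. Independence condition. Let $n\ge2$ and $0=a_0<a_1<\dots<a_n=1$. The fragments $\{X_k\}\cap[a_{i-1},a_i)$ are called independent if there exist random variables $Y_{i,j}$ ($i\le n$, $j\ge1$) on some probability space such that: - the random countable set $\{Y_{i,j}\}$ is distributed like $\{X_k\}$; - $Y_{i,j}\in[a_{i-1},a_i)$ a.s.; - the $n$ sequences $(Y_{i,j})_j$ are independent. The random dense countable set satisfies the independence condition if this holds for all $n\ge2$ and all such $a_i$. Uniform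 distribution. The set has the uniform distribution if it is identically distributed with some $\{Y_1,Y_2,\dots\}$ whose joint law $\nu$ satisfies: - (i) for every $n$, the law of $(Y_1,\dots,Y_n)$ has a density $f_n$ on $(0,1)^n$; - (ii) for Lebesgue-a.e. $x$ and $\nu$-a.e. $(y_k)$, $\sum_n f_{n+1}(y_1,\dots,y_n,x)/f_n(y_1,\dots,y_n)=\infty$. *)

theory Defs
  imports "HOL-Probability.Probability"
begin

definition seq_law :: "'a measure \<Rightarrow> (nat \<Rightarrow> 'a \<Rightarrow> real) \<Rightarrow> (nat \<Rightarrow> real) measure" where
  "seq_law M X = distr M (PiM UNIV (\<lambda>_. borel)) (\<lambda>\<omega> k. X k \<omega>)"

text \<open>Two laws M1, M2 whose associated (random) sets S1, S2 are identically distributed: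
  there is a coupling P with these marginals under which the sets coincide almost surely.\<close>
definition coupled_sets :: "'b measure \<Rightarrow> ('b \<Rightarrow> real set) \<Rightarrow> 'c measure \<Rightarrow> ('c \<Rightarrow> real set) \<Rightarrow> bool" where
  "coupled_sets M1 S1 M2 S2 \<longleftrightarrow>
     (\<exists>P :: ('b \<times> 'c) measure. prob_space P \<and> sets P = sets (M1 \<Otimes>\<^sub>M M2) \<and>
        distr P M1 fst = M1 \<and> distr P M2 snd = M2 \<and>
        (AE p in P. S1 (fst p) = S2 (snd p)))"

definition random_countable_subset :: "'a measure \<Rightarrow> (nat \<Rightarrow> 'a \<Rightarrow> real) \<Rightarrow> bool" where
  "random_countable_subset M X \<longleftrightarrow> prob_space M \<and> (\<forall>k. X k \<in> borel_measurable M) \<and>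
     (\<forall>k. \<forall>\<omega>\<in>space M. X k \<omega> \<in> {0<..<1})"

definition random_dense_countable_subset :: "'a measure \<Rightarrow> (nat \<Rightarrow> 'a \<Rightarrow> real) \<Rightarrow> bool" where
  "random_dense_countable_subset M X \<longleftrightarrow> random_countable_subset M X \<and>
     (AE \<omega> in M. {0<..<1} \<subseteq> closure (range (\<lambda>k. X k \<omega>)))"

text \<open>Independence of fragments for the partition points a 0 < a 1 < ... < a n (0-based fragments
  [a i, a (i+1)), i < n). The random variables Y i j are taken WLOG as the coordinates of
  the canonical space (nat => nat => real) under their joint law Q.\<close>
definition fragments_independent :: "'a measure \<Rightarrow> (nat \<Rightarrow> 'a \<Rightarrow> real) \<Rightarrow> nat \<Rightarrow> (nat \<Rightarrow> real) \<Rightarrow> bool" where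
  "fragments_independent M X n a \<longleftrightarrow>
     (\<exists>Q :: (nat \<Rightarrow> nat \<Rightarrow> real) measure.
        prob_space Q \<and> sets Q = sets (PiM UNIV (\<lambda>_. PiM UNIV (\<lambda>_. borel))) \<and>
        coupled_sets (seq_law M X) (\<lambda>x. range x) Q (\<lambda>y. {y i j | i j. i < n}) \<and>
        (\<forall>i<n. AE y in Q. \<forall>j. a i \<le> y i j \<and> y i j < a (Suc i)) \<and>
        prob_space.indep_vars Q (\<lambda>_. PiM UNIV (\<lambda>_. borel)) (\<lambda>i y. y i) {..<n})"

definition independence_condition :: "'a measure \<Rightarrow> (nat \<Rightarrow> 'a \<Rightarrow> real) \<Rightarrow> bool" where
  "independence_condition M X \<longleftrightarrow>
     (\<forall>n\<ge>2. \<forall>a::nat \<Rightarrow> real. a 0 = 0 \<and> a n = 1 \<and> (\<forall>i<n. a i < a (Suc i)) \<longrightarrow>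
        fragments_independent M X n a)"

text \<open>Uniform distribution. The sequence Y is taken as coordinates of (nat => real) under its
  law nu; f n is the density of (Y_1,...,Y_n) (0-based: coordinates below n) w.r.t. Lebesgue
  measure on R^n (equivalently on (0,1)^n, as nu is supported there).\<close>
definition uniform_distribution :: "'a measure \<Rightarrow> (nat \<Rightarrow> 'a \<Rightarrow> real) \<Rightarrow> bool" where
  "uniform_distribution M X \<longleftrightarrow>
     (\<exists>\<nu> :: (nat \<Rightarrow> real) measure.
        prob_space \<nu> \<and> sets \<nu> = sets (PiM UNIV (\<lambda>_. borel)) \<and>
        (AE y in \<nu>. \<forall>k. y k \<in> {0<..<1}) \<and>
        coupled_sets (seq_law M X) (\<lambda>x. range x) \<nu> (\<lambda>y. range y) \<and>
        (\<exists>f :: nat \<Rightarrow> (nat \<Rightarrow> real) \<Rightarrow> real.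
           (\<forall>n\<ge>1. f n \<in> borel_measurable (PiM {..<n} (\<lambda>_. lborel)) \<and> (\<forall>z. 0 \<le> f n z) \<and>
              distr \<nu> (PiM {..<n} (\<lambda>_. lborel)) (\<lambda>y. restrict y {..<n}) =
                density (PiM {..<n} (\<lambda>_. lborel)) (\<lambda>z. ennreal (f n z))) \<and>
           (AE x in lborel. x \<in> {0<..<1} \<longrightarrow>
              (AE y in \<nu>. \<not> summable (\<lambda>m.
                  f (m + 2) (restrict (y(Suc m := x)) {..<m + 2}) / f (m + 1) (restrict y {..<m + 1}))))))"

end

theory Submission
  imports Defs
begin

text \<open>
  If the conditional densities sum to infinity, then the expected number of first visits to a set of positive
  measure, computed on the event that it is missed, is infinite unless this event is null.

  Conversely, independence of the fragments upgrades the assumption on fixed sets \<open>B\<close> to random ones: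
  for a set \<open>C\<close> in \<open>\<real>\<^sup>n \<times> \<real>\<close>, almost surely every tuple \<open>v\<close> of points of the random set has the property that
  the section of \<open>C\<close> at \<open>v\<close> contains a further point iff it has positive measure (localize to a rational
  interval avoiding \<open>v\<close>, whose fragment is independent of the rest). Hence every tuple of
  distinct points, however selected, has an absolutely continuous law, and given such a tuple an acceptance and
  rejection scheme selects a further point of the set which is uniform on \<open>(0,1)\<close> and independent of the tuple.
  The required enumeration alternates between such uniform choices, whose conditional density is \<open>1\<close>, so that
  the series diverges, and the first point not yet enumerated, so that the set is exhausted.
\<close>

text \<open>Both implications pass through \<open>hits_uniformly\<close>. The obstacle in the harder
  one is that the exceptional null set there depends on \<open>B\<close>, so nothing is said about a
  set chosen in view of points already selected. Neither kind of enumeration step suffices alone: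
  uniform choices might omit some points for ever, while the first point not yet listed has a
  conditional density that cannot be controlled. Alternation works because infinitely many terms
  equal to 1 already make a series of nonnegative terms diverge, so for the other steps the mere
  existence of densities is enough. Selecting a uniform point requires external randomness. The
  enumeration therefore lives on the product of the law of the sequence with countably many uniform
  variables, one fresh coordinate per step; the original sequence stays available as first component
  and supplies the coupling. Since densities are determined only almost everywhere, the version at
  odd lengths is prescribed explicitly, which makes the relevant quotients exactly 1 for every
  \<open>x\<close> in the unit interval.\<close>

abbreviation unit_uniform :: "real measure" where
  "unit_uniform \<equiv> uniform_measure lborel {0<..<1}"

abbreviation real_seqs :: "(nat \<Rightarrow> real) measure" where
  "real_seqs \<equiv> PiM UNIV (\<lambda>_. borel)"

abbreviation real_tuples :: "nat \<Rightarrow> (nat \<Rightarrow> real) measure" where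
  "real_tuples n \<equiv> PiM {..<n} (\<lambda>_. borel)"

text \<open>Using \<open>unit_uniform\<close> instead of Lebesgue measure lets \<open>B\<close>
  range over all Borel sets of the line. The equivalence packs the two alternatives, probability 0
  and probability 1, into a single almost sure statement.\<close>

definition hits_uniformly :: "(nat \<Rightarrow> real) measure \<Rightarrow> bool" where
  "hits_uniformly S \<longleftrightarrow>
     (\<forall>B\<in>sets borel. AE x in S. emeasure unit_uniform B \<noteq> 0 \<longleftrightarrow> (\<exists>k. x k \<in> B))"

text \<open>The analogue of \<open>hits_uniformly\<close> for sets that depend on points of the
  random set; \<open>n = 0\<close> gives it back. One null set serves all tuples \<open>v\<close>,
  hence also tuples selected by an arbitrary rule. The entries of \<open>v\<close> must be excluded
  on the right: the diagonal has null sections, yet it contains every point paired with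
  itself.\<close>

definition saturated :: "(nat \<Rightarrow> real) measure \<Rightarrow> bool" where
  "saturated S \<longleftrightarrow>
     (\<forall>n. \<forall>C\<in>sets (real_tuples n \<Otimes>\<^sub>M borel). AE x in S. \<forall>v\<in>{..<n} \<rightarrow>\<^sub>E range x.
        emeasure unit_uniform (Pair v -` C) \<noteq> 0 \<longleftrightarrow> (\<exists>k. x k \<notin> v ` {..<n} \<and> (v, x k) \<in> C))"

section \<open>Transfer along couplings, tuples of indices, and random sections\<close>

lemma prob_space_unit_uniform: "prob_space unit_uniform"
  by (rule prob_space_uniform_measure) auto

lemma AE_from_marginal:
  assumes "distr P N g = N" "g \<in> measurable P N" "AE x in N. \<Phi> x"
  shows "AE p in P. \<Phi> (g p)"
  by (rule AE_distrD[OF assms(2)]) (subst assms(1), fact assms(3))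

lemma AE_to_marginal:
  assumes "distr P N g = N" "g \<in> measurable P N" "Measurable.pred N \<Phi>" "AE p in P. \<Phi> (g p)"
  shows "AE x in N. \<Phi> x"
  by (subst assms(1)[symmetric], subst AE_distr_iff) (use assms in \<open>simp_all add: pred_def\<close>)

text \<open>Trades the random set of tuples over \<open>range x\<close> for the fixed countable set
  of index tuples \<open>g\<close>, so that \<open>AE\<close> commutes with the quantifier over
  \<open>v\<close>.\<close>

lemma tuple_in_rangeE:
  assumes "v \<in> {..<n} \<rightarrow>\<^sub>E range x"
  obtains g where "g \<in> {..<n::nat} \<rightarrow>\<^sub>E UNIV" "v = (\<lambda>l\<in>{..<n}. x (g l))"
proof -
  have "\<forall>l\<in>{..<n}. \<exists>k. v l = x k" using assms by (auto simp: PiE_iff)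
  then obtain h where h: "\<forall>l\<in>{..<n}. v l = x (h l)" by metis
  have "v = (\<lambda>l\<in>{..<n}. x (restrict h {..<n} l))"
    using assms h by (auto simp: PiE_iff fun_eq_iff extensional_def)
  then show ?thesis using that[of "restrict h {..<n}"] by auto
qed

lemma countable_index_tuples: "countable ({..<n::nat} \<rightarrow>\<^sub>E (UNIV :: 'i::countable set))"
  by (rule countable_PiE) auto

lemma measurable_index_tuple [measurable]:
  "(\<lambda>x. \<lambda>l\<in>{..<n}. x (g l)) \<in> measurable real_seqs (real_tuples n)"
  by (rule measurable_restrict) measurable

lemma pred_emeasure_section:
  assumes [measurable]: "C \<in> sets (N \<Otimes>\<^sub>M borel)" and "prob_space U" and [measurable_cong]: "sets U = sets borel"
  shows "Measurable.pred N (\<lambda>v. emeasure U (Pair v -` C) = 0)"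
proof -
  interpret prob_space U by fact
  have "C \<in> sets (N \<Otimes>\<^sub>M U)" using assms by (simp cong: sets_pair_measure_cong)
  then have "(\<lambda>v. emeasure U (Pair v -` C)) \<in> borel_measurable N" by (rule measurable_emeasure_Pair)
  then show ?thesis by measurable
qed

text \<open>By independence the joint law of \<open>v\<close> and \<open>Z\<close> is a product, so
  Fubini allows the value \<open>w\<close> of \<open>v\<close> to be frozen. The section at
  \<open>w\<close> is then a fixed Borel set, to which \<open>hits\<close> applies.\<close>

lemma indep_section_hits:
  assumes Q: "prob_space Q" and iv: "prob_space.indep_var Q N v real_seqs Z"
    and C: "C \<in> sets (N \<Otimes>\<^sub>M borel)" and U: "prob_space U" "sets U = sets borel"
    and hits: "\<And>B. B \<in> sets borel \<Longrightarrow> AE y in Q. emeasure U (B \<inter> I) \<noteq> 0 \<longleftrightarrow> (\<exists>j. Z y j \<in> B \<inter> I)"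
    and I: "I \<in> sets borel"
  shows "AE y in Q. emeasure U (Pair (v y) -` C \<inter> I) \<noteq> 0 \<longleftrightarrow> (\<exists>j. Z y j \<in> I \<and> (v y, Z y j) \<in> C)"
proof -
  interpret prob_space Q by fact
  note [measurable] = C I
  have v [measurable]: "v \<in> measurable Q N" and Z [measurable]: "Z \<in> measurable Q real_seqs"
    using iv indep_var_rv1 indep_var_rv2 by blast+
  have eq: "distr Q N v \<Otimes>\<^sub>M distr Q real_seqs Z = distr Q (N \<Otimes>\<^sub>M real_seqs) (\<lambda>y. (v y, Z y))"
    using iv by (simp add: indep_var_distribution_eq)
  interpret A: prob_space "distr Q N v" by (rule prob_space_distr) fact
  interpret B: prob_space "distr Q real_seqs Z" by (rule prob_space_distr) fact
  interpret AB: pair_prob_space "distr Q N v" "distr Q real_seqs Z" ..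
  \<comment> \<open>Absorbing \<open>I\<close> into the set turns the restricted section into a
    plain section, for which measurability is known.\<close>
  define C' where "C' = C \<inter> (space N \<times> I)"
  have C': "C' \<in> sets (N \<Otimes>\<^sub>M borel)" unfolding C'_def by measurable
  have sec: "Pair w -` C' = Pair w -` C \<inter> I" if "w \<in> space N" for w
    using that by (auto simp: C'_def)
  define \<Phi> where "\<Phi> = (\<lambda>(w, z :: nat \<Rightarrow> real). emeasure U (Pair w -` C') = 0 \<longleftrightarrow> \<not> (\<exists>j. (w, z j) \<in> C'))"
  note [measurable] = pred_emeasure_section[OF C' U] C'
  have m1: "Measurable.pred (N \<Otimes>\<^sub>M real_seqs) (\<lambda>p. emeasure U (Pair (fst p) -` C') = 0)"
    by (rule measurable_compose[OF measurable_fst pred_emeasure_section[OF C' U]])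
  have m2: "Measurable.pred (N \<Otimes>\<^sub>M real_seqs) (\<lambda>p. \<not> (\<exists>j. (fst p, snd p j) \<in> C'))"
    by measurable
  have mPhi: "Measurable.pred (N \<Otimes>\<^sub>M real_seqs) \<Phi>"
    unfolding \<Phi>_def split_beta' by (rule pred_intros_logic(6)[OF m1 m2])
  have *: "AE z in distr Q real_seqs Z. \<Phi> (w, z)" if w: "w \<in> space N" for w
  proof -
    have Cw: "Pair w -` C \<in> sets borel" using sets_Pair1[OF C] .
    have "Measurable.pred real_seqs (\<lambda>z. \<Phi> (w, z))"
      by (rule measurable_compose[OF measurable_Pair1'[OF w] mPhi])
    moreover have "AE y in Q. \<Phi> (w, Z y)"
      using hits[OF Cw] by eventually_elim (use w in \<open>auto simp: \<Phi>_def sec C'_def\<close>)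
    ultimately show ?thesis by (subst AE_distr_iff) (auto simp: pred_def)
  qed
  have "AE p in distr Q N v \<Otimes>\<^sub>M distr Q real_seqs Z. \<Phi> p"
    by (rule AB.AE_pair_measure) (use mPhi * in \<open>auto simp: pred_def cong: sets_pair_measure_cong simp: space_pair_measure\<close>)
  then have "AE y in Q. \<Phi> (v y, Z y)"
    unfolding eq by (rule AE_distrD[rotated]) measurable
  then show ?thesis
    using AE_space by eventually_elim (use v[THEN measurable_space] in \<open>auto simp: \<Phi>_def sec C'_def\<close>)
qed

section \<open>Saturation from independence of fragments\<close>

text \<open>The coupling carries the hitting property from \<open>S\<close> to fragment 1 of
  \<open>Q\<close>. Under \<open>Q\<close>, a tuple of points from fragments 0 and 2 is independent
  of fragment 1, so \<open>indep_section_hits\<close> applies; its conclusion returns to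
  \<open>S\<close> along the same coupling.\<close>

lemma independent_fragment_saturated:
  assumes S: "prob_space S" "sets S = sets real_seqs" "hits_uniformly S" and ab: "a < b"
    and Q: "prob_space Q" "sets Q = sets (PiM UNIV (\<lambda>_. real_seqs))"
    and coup: "coupled_sets S range Q (\<lambda>y. {y i j | i j. i < 3})"
    and frag: "\<forall>i<3. AE y in Q. \<forall>j. pt i \<le> y i j \<and> y i j < pt (Suc i)"
    and pt: "pt (Suc 0) = a" "pt 2 = b"
    and indep: "prob_space.indep_vars Q (\<lambda>_. real_seqs) (\<lambda>i y. y i) {..<3}"
    and D: "D \<in> sets (real_tuples n \<Otimes>\<^sub>M borel)"
  shows "AE x in S. \<forall>v\<in>{..<n} \<rightarrow>\<^sub>E (range x - {a..<b}).
    emeasure unit_uniform (Pair v -` D \<inter> {a..<b}) \<noteq> 0 \<longleftrightarrow> (\<exists>k. x k \<in> {a..<b} \<and> (v, x k) \<in> D)"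
proof -
  let ?U = unit_uniform and ?I = "{a..<b}"
  interpret S: prob_space S by fact
  interpret Q: prob_space Q by fact
  note [measurable_cong] = S(2) Q(2) and [measurable] = D
  obtain P where P: "prob_space P" "sets P = sets (S \<Otimes>\<^sub>M Q)" "distr P S fst = S" "distr P Q snd = Q"
    "AE p in P. range (fst p) = {snd p i j | i j. i < 3}"
    using coup unfolding coupled_sets_def by auto
  have mfst: "fst \<in> measurable P S" and msnd: "snd \<in> measurable P Q"
    using measurable_cong_sets[OF P(2) refl] by auto
  have [measurable]: "(\<lambda>y. y i j) \<in> borel_measurable Q" for i j
    by (rule measurable_compose[of "\<lambda>y. y i" Q real_seqs]) measurable
  have frag_all: "AE y in Q. \<forall>i<3. \<forall>j. pt i \<le> y i j \<and> y i j < pt (Suc i)"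
    using frag by (subst AE_all_countable) auto
  \<comment> \<open>The quantifier over all predicates \<open>R\<close> costs no measurability: it
    is a pointwise consequence of the equality of the two sets, on one event of full
    probability.\<close>
  have same: "AE p in P. range (fst p) = {snd p i j | i j. i < 3} \<and>
      (\<forall>i<3. \<forall>j. snd p i j \<in> ?I \<longleftrightarrow> i = 1) \<and>
      (\<forall>R. (\<exists>k. fst p k \<in> ?I \<and> R (fst p k)) \<longleftrightarrow> (\<exists>j. snd p 1 j \<in> ?I \<and> R (snd p 1 j)))"
    using P(5) AE_from_marginal[OF P(4) msnd frag_all]
  proof eventually_elim
    case (elim p)
    have mid: "snd p i j \<in> ?I \<longleftrightarrow> i = 1" if "i < 3" for i j
    proof -
      have "i = 0 \<or> i = 1 \<or> i = 2" using that by auto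
      moreover have "pt i \<le> snd p i j" "snd p i j < pt (Suc i)" using elim that by auto
      ultimately show ?thesis using pt ab by (auto simp: numeral_2_eq_2)
    qed
    have "(\<exists>k. fst p k \<in> ?I \<and> R (fst p k)) \<longleftrightarrow> (\<exists>j. snd p 1 j \<in> ?I \<and> R (snd p 1 j))" for R
    proof
      assume "\<exists>k. fst p k \<in> ?I \<and> R (fst p k)"
      then obtain k where k: "fst p k \<in> ?I" "R (fst p k)" by blast
      have "fst p k \<in> {snd p i j | i j. i < 3}" using elim(1) by (metis rangeI)
      then obtain i j where ij: "i < 3" "fst p k = snd p i j" by blast
      then have "i = 1" using mid[OF ij(1), of j] k(1) by simp
      then show "\<exists>j. snd p 1 j \<in> ?I \<and> R (snd p 1 j)" using k ij(2) by metis
    next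
      assume "\<exists>j. snd p 1 j \<in> ?I \<and> R (snd p 1 j)"
      then obtain j where j: "snd p 1 j \<in> ?I" "R (snd p 1 j)" by blast
      have "snd p 1 j \<in> {snd p i j | i j. i < 3}"
        by (rule CollectI, rule exI[of _ 1], rule exI[of _ j]) simp
      then obtain k where "snd p 1 j = fst p k" using elim(1) by (metis rangeE)
      then show "\<exists>k. fst p k \<in> ?I \<and> R (fst p k)" using j by metis
    qed
    then show ?case using elim(1) mid by blast
  qed
  have hitQ: "AE y in Q. emeasure ?U (B \<inter> ?I) \<noteq> 0 \<longleftrightarrow> (\<exists>j. y 1 j \<in> B \<inter> ?I)"
    if [measurable]: "B \<in> sets borel" for B
  proof (rule AE_to_marginal[OF P(4) msnd])
    show "Measurable.pred Q (\<lambda>y. emeasure ?U (B \<inter> ?I) \<noteq> 0 \<longleftrightarrow> (\<exists>j. y 1 j \<in> B \<inter> ?I))"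
      by (rule pred_intros_logic(6)) measurable
    have "AE x in S. emeasure ?U (B \<inter> ?I) \<noteq> 0 \<longleftrightarrow> (\<exists>k. x k \<in> B \<inter> ?I)"
      using S(3) unfolding hits_uniformly_def by (rule bspec) simp
    from AE_from_marginal[OF P(3) mfst this] same
    show "AE p in P. emeasure ?U (B \<inter> ?I) \<noteq> 0 \<longleftrightarrow> (\<exists>j. snd p 1 j \<in> B \<inter> ?I)"
    proof eventually_elim
      case (elim p)
      have "(\<exists>k. fst p k \<in> ?I \<and> fst p k \<in> B) \<longleftrightarrow> (\<exists>j. snd p 1 j \<in> ?I \<and> snd p 1 j \<in> B)"
        using elim(2) by (elim conjE allE[of _ "\<lambda>s. s \<in> B"])
      then show ?case using elim(1) by (simp add: Int_iff conj_commute)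
    qed
  qed
  \<comment> \<open>An index is a pair (fragment, position within the fragment), so it is visible
    from \<open>g\<close> alone which fragments the tuple depends on.\<close>
  define tup where "tup g y = (\<lambda>l\<in>{..<n}. y (fst (g l)) (snd (g l)))"
    for g :: "nat \<Rightarrow> nat \<times> nat" and y :: "nat \<Rightarrow> nat \<Rightarrow> real"
  have secQ: "AE y in Q. emeasure ?U (Pair (tup g y) -` D \<inter> ?I) \<noteq> 0 \<longleftrightarrow>
      (\<exists>j. y 1 j \<in> ?I \<and> (tup g y, y 1 j) \<in> D)" if g: "\<forall>l<n. fst (g l) \<in> {0, 2}" for g
  proof (rule indep_section_hits[OF Q(1) _ D prob_space_unit_uniform _ hitQ])
    let ?X = "\<lambda>A y. restrict (\<lambda>i. y i) A"
    have "Q.indep_var (PiM {0, 2} (\<lambda>_. real_seqs)) (?X {0, 2}) (PiM {1} (\<lambda>_. real_seqs)) (?X {1})"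
      by (rule Q.indep_var_restrict[OF indep]) auto
    then have "Q.indep_var (real_tuples n) (tup g \<circ> ?X {0, 2}) real_seqs ((\<lambda>z. z 1) \<circ> ?X {1})"
    proof (rule Q.indep_var_compose)
      show "tup g \<in> measurable (PiM {0, 2} (\<lambda>_. real_seqs)) (real_tuples n)"
        unfolding tup_def
      proof (rule measurable_restrict)
        fix l assume "l \<in> {..<n}"
        then have "(\<lambda>y. y (fst (g l))) \<in> measurable (PiM {0, 2} (\<lambda>_. real_seqs)) real_seqs"
          using g by (intro measurable_component_singleton) auto
        then show "(\<lambda>y. y (fst (g l)) (snd (g l))) \<in> borel_measurable (PiM {0, 2} (\<lambda>_. real_seqs))"
          by (rule measurable_compose) measurable
      qed
    qed measurable
    moreover have "tup g \<circ> ?X {0, 2} = tup g" using g by (auto simp: tup_def fun_eq_iff)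
    moreover have "(\<lambda>z. z 1) \<circ> ?X {1} = (\<lambda>y :: nat \<Rightarrow> nat \<Rightarrow> real. y 1)" by (auto simp: fun_eq_iff)
    ultimately show "Q.indep_var (real_tuples n) (tup g) real_seqs (\<lambda>y. y 1)" by simp
  qed auto
  let ?G = "{..<n} \<rightarrow>\<^sub>E (UNIV :: (nat \<times> nat) set)"
  have "AE y in Q. \<forall>g\<in>?G. (\<forall>l<n. fst (g l) \<in> {0, 2}) \<longrightarrow>
      (emeasure ?U (Pair (tup g y) -` D \<inter> ?I) \<noteq> 0 \<longleftrightarrow> (\<exists>j. y 1 j \<in> ?I \<and> (tup g y, y 1 j) \<in> D))"
    using secQ by (subst AE_ball_countable[OF countable_index_tuples]) auto
  from AE_from_marginal[OF P(4) msnd this] same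
  have fin: "AE p in P. \<forall>v\<in>{..<n} \<rightarrow>\<^sub>E (range (fst p) - ?I).
    emeasure ?U (Pair v -` D \<inter> ?I) \<noteq> 0 \<longleftrightarrow> (\<exists>k. fst p k \<in> ?I \<and> (v, fst p k) \<in> D)"
  proof eventually_elim
    case (elim p)
    show ?case
    proof
      fix v assume v: "v \<in> {..<n} \<rightarrow>\<^sub>E (range (fst p) - ?I)"
      \<comment> \<open>All of fragment 1 lies in the interval, so a point outside it must come from
        fragment 0 or 2.\<close>
      have "\<forall>l\<in>{..<n}. \<exists>ij. v l = snd p (fst ij) (snd ij) \<and> fst ij \<in> {0, 2}"
      proof
        fix l assume "l \<in> {..<n}"
        then have "v l \<in> range (fst p)" "v l \<notin> ?I" using v by (auto simp: PiE_iff simp del: atLeastLessThan_iff)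
        moreover have "range (fst p) = {snd p i j | i j. i < 3}" using elim(2) by (rule conjunct1)
        ultimately have vl: "v l \<in> {snd p i j | i j. i < 3}" "v l \<notin> ?I" by auto
        then obtain i j where ij: "v l = snd p i j" "i < 3" by blast
        have "snd p i j \<in> ?I \<longleftrightarrow> i = 1"
          by (rule elim(2)[THEN conjunct2, THEN conjunct1, rule_format, OF ij(2)])
        with ij vl(2) show "\<exists>ij. v l = snd p (fst ij) (snd ij) \<and> fst ij \<in> {0, 2}"
          by (intro exI[of _ "(i, j)"]) auto
      qed
      then obtain h where h: "\<forall>l\<in>{..<n}. v l = snd p (fst (h l)) (snd (h l)) \<and> fst (h l) \<in> {0, 2}" by metis
      have vh: "v = tup (restrict h {..<n}) (snd p)"
        using v h by (auto simp: tup_def PiE_iff fun_eq_iff extensional_def)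
      have "emeasure ?U (Pair v -` D \<inter> ?I) \<noteq> 0 \<longleftrightarrow> (\<exists>j. snd p 1 j \<in> ?I \<and> (v, snd p 1 j) \<in> D)"
        unfolding vh by (rule elim(1)[rule_format]) (use h in auto)
      also have "\<dots> \<longleftrightarrow> (\<exists>k. fst p k \<in> ?I \<and> (v, fst p k) \<in> D)"
        using elim(2) by (elim conjE allE[of _ "\<lambda>s. (v, s) \<in> D"]) (rule sym)
      finally show "emeasure ?U (Pair v -` D \<inter> ?I) \<noteq> 0 \<longleftrightarrow> (\<exists>k. fst p k \<in> ?I \<and> (v, fst p k) \<in> D)" .
    qed
  qed
  \<comment> \<open>Descending from \<open>P\<close> to its marginal \<open>S\<close> needs a
    measurable predicate. The claim is therefore restated as \<open>\<Psi> g\<close> for each fixed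
    index tuple \<open>g\<close>, with the interval absorbed into \<open>D'\<close>, and the
    countably many results are reassembled afterwards.\<close>
  define tup' where "tup' g x = (\<lambda>l\<in>{..<n}. x (g l))" for g :: "nat \<Rightarrow> nat" and x :: "nat \<Rightarrow> real"
  define D' where "D' = D \<inter> (space (real_tuples n) \<times> ?I)"
  have D' [measurable]: "D' \<in> sets (real_tuples n \<Otimes>\<^sub>M borel)" unfolding D'_def by measurable
  define \<Psi> where "\<Psi> g x \<longleftrightarrow> (\<forall>l<n. x (g l) \<notin> ?I) \<longrightarrow>
     (emeasure ?U (Pair (tup' g x) -` D') = 0 \<longleftrightarrow> \<not> (\<exists>k. (tup' g x, x k) \<in> D'))" for g x
  have tup'_space: "tup' g x \<in> space (real_tuples n)" for g x by (auto simp: tup'_def space_PiM)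
  have sec: "Pair (tup' g x) -` D' = Pair (tup' g x) -` D \<inter> ?I" for g x
    using tup'_space[of g x] by (auto simp: D'_def)
  have "AE x in S. \<Psi> g x" for g
  proof (rule AE_to_marginal[OF P(3) mfst])
    have [measurable]: "tup' g \<in> measurable S (real_tuples n)" unfolding tup'_def by measurable
    have 1: "Measurable.pred S (\<lambda>x. emeasure ?U (Pair (tup' g x) -` D') = 0)"
      by (rule measurable_compose[OF _ pred_emeasure_section[OF D' prob_space_unit_uniform]]) auto
    have *: "(\<lambda>x. x k) \<in> borel_measurable S" for k
      using measurable_component_singleton[of k UNIV "\<lambda>_. borel"] by (simp add: measurable_cong_sets[OF S(2) refl])
    then have "(\<lambda>x. (tup' g x, x k)) \<in> measurable S (real_tuples n \<Otimes>\<^sub>M borel)" for k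
      by (intro measurable_Pair *) auto
    then have 2: "Measurable.pred S (\<lambda>x. \<not> (\<exists>k. (tup' g x, x k) \<in> D'))"
      by (intro pred_intros_logic(2) pred_intros_countable(2)) (rule pred_sets2[OF D'])
    note [measurable] = *
    have 3: "Measurable.pred S (\<lambda>x. \<forall>l<n. x (g l) \<notin> ?I)" by measurable
    show "Measurable.pred S (\<Psi> g)"
      unfolding \<Psi>_def by (rule pred_intros_logic(4)[OF 3 pred_intros_logic(6)[OF 1 2]])
    show "AE p in P. \<Psi> g (fst p)"
      using fin
    proof eventually_elim
      case (elim p)
      show ?case unfolding \<Psi>_def
      proof
        assume "\<forall>l<n. fst p (g l) \<notin> ?I"
        then have "tup' g (fst p) \<in> {..<n} \<rightarrow>\<^sub>E (range (fst p) - ?I)" by (auto simp: tup'_def)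
        from elim[rule_format, OF this] tup'_space[of g "fst p"]
        show "emeasure ?U (Pair (tup' g (fst p)) -` D') = 0 \<longleftrightarrow> \<not> (\<exists>k. (tup' g (fst p), fst p k) \<in> D')"
          unfolding sec by (auto simp: D'_def)
      qed
    qed
  qed
  then have "AE x in S. \<forall>g\<in>{..<n} \<rightarrow>\<^sub>E UNIV. \<Psi> g x"
    by (subst AE_ball_countable[OF countable_index_tuples]) auto
  then show ?thesis
  proof eventually_elim
    case (elim x)
    show ?case
    proof
      fix v assume v: "v \<in> {..<n} \<rightarrow>\<^sub>E (range x - ?I)"
      then have "v \<in> {..<n} \<rightarrow>\<^sub>E range x" by (auto simp: PiE_iff)
      then obtain g where g: "g \<in> {..<n} \<rightarrow>\<^sub>E UNIV" "v = tup' g x"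
        by (rule tuple_in_rangeE) (auto simp: tup'_def)
      have "\<forall>l<n. x (g l) \<notin> ?I" using v g(2) by (auto simp: tup'_def PiE_iff)
      with elim g(1) have "emeasure ?U (Pair v -` D') = 0 \<longleftrightarrow> \<not> (\<exists>k. (v, x k) \<in> D')"
        unfolding \<Psi>_def g(2) by blast
      then show "emeasure ?U (Pair v -` D \<inter> ?I) \<noteq> 0 \<longleftrightarrow> (\<exists>k. x k \<in> ?I \<and> (v, x k) \<in> D)"
        using tup'_space[of g x] unfolding g(2) sec by (auto simp: D'_def)
    qed
  qed
qed

lemma rational_interval_avoiding:
  fixes s :: real
  assumes "finite F" "s \<in> {0<..<1} - F"
  obtains a b where "a \<in> \<rat>" "b \<in> \<rat>" "0 < a" "a < b" "b < 1" "s \<in> {a..<b}" "{a..<b} \<inter> F = {}"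
proof -
  have "open ({0<..<1} - F)" using assms(1) by (simp add: open_Diff finite_imp_closed)
  then obtain e where e: "e > 0" "ball s e \<subseteq> {0<..<1} - F" using assms(2) openE by blast
  obtain a where a: "a \<in> \<rat>" "s - e < a" "a < s" using Rats_dense_in_real[of "s - e" s] e(1) by auto
  obtain b where b: "b \<in> \<rat>" "s < b" "b < s + e" using Rats_dense_in_real[of s "s + e"] e(1) by auto
  have "z \<in> ball s e" if "a \<le> z" "z \<le> b" for z
    using that a b by (auto simp: dist_real_def)
  then have *: "z \<in> {0<..<1} - F" if "a \<le> z" "z \<le> b" for z using e(2) that by blast
  then show ?thesis using that[of a b] a b *[of a] *[of b] by fastforce
qed

text \<open>Localization to countably many rational intervals. A point outside \<open>v\<close> has
  such an interval around it that avoids \<open>v\<close>, which gives positive measure. Conversely,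
  the intervals avoiding \<open>v\<close> cover the unit interval up to finitely many points, so a
  section of positive measure has positive measure in one of them, and the local statement produces
  a point there.\<close>

lemma saturatedI:
  assumes S: "prob_space S" "hits_uniformly S"
    and frag: "\<And>n D a b. D \<in> sets (real_tuples n \<Otimes>\<^sub>M borel) \<Longrightarrow> 0 < a \<Longrightarrow> a < b \<Longrightarrow> b < 1 \<Longrightarrow>
      AE x in S. \<forall>v\<in>{..<n} \<rightarrow>\<^sub>E (range x - {a..<b}).
        emeasure unit_uniform (Pair v -` D \<inter> {a..<b}) \<noteq> 0 \<longleftrightarrow> (\<exists>k. x k \<in> {a..<b} \<and> (v, x k) \<in> D)"
  shows "saturated S"
  unfolding saturated_def
proof (intro allI ballI)
  fix n and D :: "((nat \<Rightarrow> real) \<times> real) set"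
  assume D: "D \<in> sets (real_tuples n \<Otimes>\<^sub>M borel)"
  let ?U = unit_uniform
  define J :: "(real \<times> real) set" where "J = {(a, b) \<in> \<rat> \<times> \<rat>. 0 < a \<and> a < b \<and> b < 1}"
  have cJ: "countable J"
    by (rule countable_subset[of _ "\<rat> \<times> \<rat>"]) (auto simp: J_def countable_rat)
  have 1: "AE x in S. \<forall>ab\<in>J. \<forall>v\<in>{..<n} \<rightarrow>\<^sub>E (range x - {fst ab..<snd ab}).
        emeasure ?U (Pair v -` D \<inter> {fst ab..<snd ab}) \<noteq> 0 \<longleftrightarrow> (\<exists>k. x k \<in> {fst ab..<snd ab} \<and> (v, x k) \<in> D)"
    by (subst AE_ball_countable[OF cJ]) (use frag[OF D] in \<open>auto simp: J_def\<close>)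
  \<comment> \<open>The complement of the unit interval is null, hence never hit: all points lie
    where the rational intervals are available.\<close>
  have "emeasure ?U (- {0<..<1}) = 0" by (subst emeasure_uniform_measure) auto
  moreover have "- {0<..<1::real} \<in> sets borel" by auto
  ultimately have 2: "AE x in S. \<forall>k. x k \<in> {0<..<1}"
    using S(2)[unfolded hits_uniformly_def, rule_format, of "- {0<..<1}"] by simp
  from 1 2
  show "AE x in S. \<forall>v\<in>{..<n} \<rightarrow>\<^sub>E range x.
        emeasure ?U (Pair v -` D) \<noteq> 0 \<longleftrightarrow> (\<exists>k. x k \<notin> v ` {..<n} \<and> (v, x k) \<in> D)"
  proof eventually_elim
    case (elim x)
    show ?case
    proof
      fix v assume v: "v \<in> {..<n} \<rightarrow>\<^sub>E range x"
      let ?F = "v ` {..<n}"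
      let ?J = "{ab \<in> J. {fst ab..<snd ab} \<inter> ?F = {}}"
      have sets: "Pair v -` D \<in> sets borel" using sets_Pair1[OF D] .
      have good: "emeasure ?U (Pair v -` D \<inter> {fst ab..<snd ab}) \<noteq> 0 \<longleftrightarrow>
          (\<exists>k. x k \<in> {fst ab..<snd ab} \<and> (v, x k) \<in> D)" if "ab \<in> ?J" for ab
        by (rule elim(1)[rule_format]) (use v that in \<open>auto simp: PiE_iff\<close>)
      show "emeasure ?U (Pair v -` D) \<noteq> 0 \<longleftrightarrow> (\<exists>k. x k \<notin> ?F \<and> (v, x k) \<in> D)"
      proof
        assume "\<exists>k. x k \<notin> ?F \<and> (v, x k) \<in> D"
        then obtain k where k: "x k \<notin> ?F" "(v, x k) \<in> D" by blast
        obtain a b where ab: "a \<in> \<rat>" "b \<in> \<rat>" "0 < a" "a < b" "b < 1" "x k \<in> {a..<b}" "{a..<b} \<inter> ?F = {}"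
          using rational_interval_avoiding[of ?F "x k"] k(1) elim(2) by auto
        then have "emeasure ?U (Pair v -` D \<inter> {a..<b}) \<noteq> 0"
          using good[of "(a, b)"] k(2) by (auto simp: J_def)
        moreover have "emeasure ?U (Pair v -` D \<inter> {a..<b}) \<le> emeasure ?U (Pair v -` D)"
          using sets by (intro emeasure_mono) auto
        ultimately show "emeasure ?U (Pair v -` D) \<noteq> 0" by auto
      next
        assume nz: "emeasure ?U (Pair v -` D) \<noteq> 0"
        have "\<exists>ab\<in>?J. emeasure ?U (Pair v -` D \<inter> {fst ab..<snd ab}) \<noteq> 0"
        proof (rule ccontr)
          assume "\<not> ?thesis"
          then have "(\<Union>ab\<in>?J. Pair v -` D \<inter> {fst ab..<snd ab}) \<in> null_sets ?U"
            using sets countable_subset[OF _ cJ, of ?J] by (intro null_sets_UN') auto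
          \<comment> \<open>The part not covered by the intervals in \<open>?J\<close>: the entries
            of \<open>v\<close> and the outside of the unit interval.\<close>
          moreover have "?F \<union> - {0<..<1} \<in> null_sets ?U"
          proof (rule null_setsI)
            have "- {0<..<1::real} \<in> sets borel" by (simp add: borel_comp)
            moreover have vF: "?F \<in> sets borel" by (intro borel_closed finite_imp_closed) simp
            ultimately have F: "?F \<union> - {0<..<1} \<in> sets borel" using sets.Un by blast
            have "emeasure lborel ({0<..<1} \<inter> (?F \<union> - {0<..<1})) \<le> emeasure lborel ?F"
              using vF by (intro emeasure_mono) auto
            also have "\<dots> = 0" by (rule emeasure_lborel_countable) (auto simp: countable_finite)
            finally show "emeasure ?U (?F \<union> - {0<..<1}) = 0"
              using F by (subst emeasure_uniform_measure) auto
            show "?F \<union> - {0<..<1} \<in> sets ?U" using F by simp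
          qed
          ultimately have "(\<Union>ab\<in>?J. Pair v -` D \<inter> {fst ab..<snd ab}) \<union> (?F \<union> - {0<..<1}) \<in> null_sets ?U"
            by (rule null_sets.Un)
          moreover have "Pair v -` D \<subseteq> (\<Union>ab\<in>?J. Pair v -` D \<inter> {fst ab..<snd ab}) \<union> (?F \<union> - {0<..<1})"
          proof
            fix s assume s: "s \<in> Pair v -` D"
            show "s \<in> (\<Union>ab\<in>?J. Pair v -` D \<inter> {fst ab..<snd ab}) \<union> (?F \<union> - {0<..<1})"
            proof (cases "s \<in> {0<..<1} - ?F")
              case True
              then obtain a b where "a \<in> \<rat>" "b \<in> \<rat>" "0 < a" "a < b" "b < 1" "s \<in> {a..<b}" "{a..<b} \<inter> ?F = {}"
                using rational_interval_avoiding[of ?F s] by auto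
              then have "(a, b) \<in> ?J" "s \<in> Pair v -` D \<inter> {fst (a, b)..<snd (a, b)}" using s by (auto simp: J_def)
              then show ?thesis by blast
            qed auto
          qed
          ultimately have "Pair v -` D \<in> null_sets ?U"
            using sets by (auto intro: null_sets_subset)
          with nz show False by auto
        qed
        then obtain ab where ab: "ab \<in> ?J" "emeasure ?U (Pair v -` D \<inter> {fst ab..<snd ab}) \<noteq> 0" by blast
        with good[OF ab(1)] obtain k where k: "x k \<in> {fst ab..<snd ab}" "(v, x k) \<in> D" by blast
        with ab(1) show "\<exists>k. x k \<notin> ?F \<and> (v, x k) \<in> D" by blast
      qed
    qed
  qed
qed

lemma saturated_seq_law:
  assumes X: "random_countable_subset M X" and indep: "independence_condition M X"
    and hits: "hits_uniformly (seq_law M X)"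
  shows "saturated (seq_law M X)"
proof -
  interpret prob_space M using X by (simp add: random_countable_subset_def)
  have [measurable]: "X k \<in> borel_measurable M" for k using X by (simp add: random_countable_subset_def)
  have ps: "prob_space (seq_law M X)" and ss: "sets (seq_law M X) = sets real_seqs"
    unfolding seq_law_def by (auto intro!: prob_space_distr measurable_PiM_single')
  show ?thesis
  proof (rule saturatedI[OF ps hits])
    fix n and D :: "((nat \<Rightarrow> real) \<times> real) set" and a b :: real
    assume D: "D \<in> sets (real_tuples n \<Otimes>\<^sub>M borel)" and ab: "0 < a" "a < b" "b < 1"
    \<comment> \<open>The partition 0 < a < b < 1: the middle fragment is the localizing interval,
      the outer two hold all tuples that avoid it.\<close>
    define pt where "pt i = (if i = 0 then 0 else if i = 1 then a else if i = 2 then b else 1)" for i :: nat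
    have "pt i < pt (Suc i)" if "i < 3" for i
      using that ab by (auto simp: pt_def)
    then have "fragments_independent M X 3 pt"
      using indep by (auto simp: independence_condition_def pt_def)
    then obtain Q where Q: "prob_space Q" "sets Q = sets (PiM UNIV (\<lambda>_. real_seqs))"
      "coupled_sets (seq_law M X) range Q (\<lambda>y. {y i j | i j. i < 3})"
      "\<forall>i<3. AE y in Q. \<forall>j. pt i \<le> y i j \<and> y i j < pt (Suc i)"
      "prob_space.indep_vars Q (\<lambda>_. real_seqs) (\<lambda>i y. y i) {..<3}"
      unfolding fragments_independent_def by blast
    show "AE x in seq_law M X. \<forall>v\<in>{..<n} \<rightarrow>\<^sub>E (range x - {a..<b}).
        emeasure unit_uniform (Pair v -` D \<inter> {a..<b}) \<noteq> 0 \<longleftrightarrow> (\<exists>k. x k \<in> {a..<b} \<and> (v, x k) \<in> D)"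
      by (rule independent_fragment_saturated[OF ps ss hits ab(2) Q(1-4) _ _ Q(5) D]) (auto simp: pt_def)
  qed
qed

section \<open>Selection of an independent uniform point\<close>

text \<open>Ensures that the acceptance rule does not overshoot: \<open>g\<close> is the density of
  a candidate, \<open>x\<close> the room left in the target density. The conventions for
  \<open>ennreal\<close> division make this true also at \<open>g = 0\<close> and
  \<open>g = top\<close>.\<close>

lemma min_quotient_times_le:
  fixes x g :: ennreal
  assumes "x < top"
  shows "min 1 (x / g) * g \<le> x"
proof -
  consider "g = 0" | "g = top" | "g \<noteq> 0" "g < top" by (metis top.not_eq_extremum)
  then show ?thesis
  proof cases
    case 2
    with assms show ?thesis by (simp add: ennreal_divide_top min_def)
  next
    case 3
    have "min 1 (x / g) * g \<le> x / g * g" by (intro mult_right_mono) auto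
    also have "\<dots> = x" using 3 by (simp add: ennreal_divide_times)
    finally show ?thesis .
  qed auto
qed

text \<open>Acceptance and rejection along the sequence of candidates \<open>X k\<close>: the candidate is accepted
  with the conditional probability \<open>a k\<close> which exhausts as much as possible of the part of the target law
  not yet covered. If the total acceptance probability were less than one, then the uncovered part
  would have positive measure over the same \<open>v\<close>, and by saturation some candidate would lie in it.\<close>

lemma selection_weights:
  fixes D :: "'a measure" and N :: "'b measure" and U :: "'c measure"
  assumes D: "prob_space D" and U: "prob_space U"
    and v [measurable]: "v \<in> measurable D N"
    and X [measurable]: "\<And>k. X k \<in> measurable D U"
    and V [measurable]: "\<And>k. Measurable.pred D (V k)"
    and sat: "\<And>C. C \<in> sets (N \<Otimes>\<^sub>M U) \<Longrightarrow>
      AE \<omega> in D. emeasure U (Pair (v \<omega>) -` C) \<noteq> 0 \<longleftrightarrow> (\<exists>k. V k \<omega> \<and> (v \<omega>, X k \<omega>) \<in> C)"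
  obtains w :: "nat \<Rightarrow> 'a \<Rightarrow> ennreal"
  where "\<And>k. w k \<in> borel_measurable D" "\<And>k \<omega>. \<not> V k \<omega> \<Longrightarrow> w k \<omega> = 0"
    "AE \<omega> in D. (\<Sum>k. w k \<omega>) = 1"
    "\<And>C. C \<in> sets (N \<Otimes>\<^sub>M U) \<Longrightarrow>
      (\<Sum>k. \<integral>\<^sup>+\<omega>. w k \<omega> * indicator C (v \<omega>, X k \<omega>) \<partial>D) = emeasure (distr D N v \<Otimes>\<^sub>M U) C"
proof -
  interpret D: prob_space D by fact
  interpret U: prob_space U by fact
  interpret L: prob_space "distr D N v" by (rule D.prob_space_distr) fact
  interpret LU: pair_prob_space "distr D N v" U ..
  \<comment> \<open>The target law: \<open>v\<close> together with an independent point distributed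
    as \<open>U\<close>.\<close>
  define E where "E = distr D N v \<Otimes>\<^sub>M U"
  interpret E: prob_space E unfolding E_def by (rule LU.P.prob_space_axioms)
  have sE [measurable_cong]: "sets E = sets (N \<Otimes>\<^sub>M U)"
    unfolding E_def by (auto cong: sets_pair_measure_cong)
  define z where "z k \<omega> = (v \<omega>, X k \<omega>)" for k \<omega>
  have z [measurable]: "z k \<in> measurable D E" for k unfolding z_def by measurable
  \<comment> \<open>Two quantities must be built together: \<open>R k\<close> is the probability,
    given the sample point, of having accepted one of the first \<open>k\<close> candidates, and
    \<open>G k\<close> is the density with respect to \<open>E\<close> of the law of the accepted
    pairs. The acceptance rule uses \<open>G\<close>, and the next candidate density uses
    \<open>R\<close>.\<close>
  define step where "step k s = (let R = fst s; G = snd s;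
      g = RN_deriv E (distr (density D (\<lambda>\<omega>. (1 - R \<omega>) * indicator {\<omega>. V k \<omega>} \<omega>)) E (z k));
      a = (\<lambda>p. min 1 ((1 - G p) / g p))
    in (\<lambda>\<omega>. R \<omega> + (1 - R \<omega>) * indicator {\<omega>. V k \<omega>} \<omega> * a (z k \<omega>), \<lambda>p. G p + a p * g p))"
    for k and s :: "('a \<Rightarrow> ennreal) \<times> ('b \<times> 'c \<Rightarrow> ennreal)"
  define st where "st = rec_nat (\<lambda>_. 0, \<lambda>_. 0) step"
  define R where "R k = fst (st k)" for k
  define G where "G k = snd (st k)" for k
  \<comment> \<open>The law of the candidate pair on the event that it is admissible, weighted with
    the probability that nothing has been accepted before.\<close>
  define \<mu> where "\<mu> k = distr (density D (\<lambda>\<omega>. (1 - R k \<omega>) * indicator {\<omega>. V k \<omega>} \<omega>)) E (z k)" for k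
  define g where "g k = RN_deriv E (\<mu> k)" for k
  define a where "a k p = min 1 ((1 - G k p) / g k p)" for k p
  define w where "w k \<omega> = (1 - R k \<omega>) * indicator {\<omega>. V k \<omega>} \<omega> * a k (z k \<omega>)" for k \<omega>
  have R0: "R 0 = (\<lambda>_. 0)" and G0: "G 0 = (\<lambda>_. 0)"
    by (simp_all add: R_def G_def st_def)
  have RS: "R (Suc k) = (\<lambda>\<omega>. R k \<omega> + w k \<omega>)" for k
    by (simp add: R_def G_def st_def step_def w_def a_def g_def \<mu>_def Let_def)
  have GS: "G (Suc k) = (\<lambda>p. G k p + a k p * g k p)" for k
    by (simp add: R_def G_def st_def step_def w_def a_def g_def \<mu>_def Let_def)
  have g [measurable]: "g k \<in> borel_measurable E" for k unfolding g_def by measurable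
  have meas: "R k \<in> borel_measurable D \<and> G k \<in> borel_measurable E" for k
  proof (induction k)
    case (Suc k)
    then have [measurable]: "R k \<in> borel_measurable D" "G k \<in> borel_measurable E" by auto
    have [measurable]: "a k \<in> borel_measurable E" unfolding a_def by measurable
    show ?case unfolding RS GS w_def by measurable
  qed (simp add: R0 G0)
  then have [measurable]: "R k \<in> borel_measurable D" "G k \<in> borel_measurable E" for k by auto
  have a [measurable]: "a k \<in> borel_measurable E" for k unfolding a_def by measurable
  have w [measurable]: "w k \<in> borel_measurable D" for k unfolding w_def by measurable
  have R1: "R k \<omega> \<le> 1" for k \<omega>
  proof (induction k)
    case (Suc k)
    have "w k \<omega> \<le> (1 - R k \<omega>) * 1 * 1"
      unfolding w_def by (intro mult_mono) (auto simp: a_def indicator_def)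
    then have "R k \<omega> + w k \<omega> \<le> R k \<omega> + (1 - R k \<omega>)" by (simp add: add_left_mono)
    also have "\<dots> = 1" using Suc by (rule add_diff_inverse_ennreal)
    finally show ?case by (simp add: RS)
  qed (simp add: R0)
  have G1: "G k p \<le> 1" for k p
  proof (induction k)
    case (Suc k)
    have "a k p * g k p \<le> 1 - G k p"
      unfolding a_def by (rule min_quotient_times_le) (simp add: ennreal_minus_if less_top[symmetric] top_unique diff_eq_0_iff_ennreal)
    then have "G k p + a k p * g k p \<le> G k p + (1 - G k p)" by (rule add_left_mono)
    also have "\<dots> = 1" using Suc by (rule add_diff_inverse_ennreal)
    finally show ?case by (simp add: GS)
  qed (simp add: G0)
  have R_sum: "R k \<omega> = (\<Sum>j<k. w j \<omega>)" for k \<omega> by (induction k) (simp_all add: R0 RS)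
  have G_sum: "G k p = (\<Sum>j<k. a j p * g j p)" for k p by (induction k) (simp_all add: G0 GS)
  define Rs where "Rs \<omega> = (\<Sum>k. w k \<omega>)" for \<omega>
  define Gs where "Gs p = (\<Sum>k. a k p * g k p)" for p
  have [measurable]: "Rs \<in> borel_measurable D" "Gs \<in> borel_measurable E"
    unfolding Rs_def Gs_def by measurable
  have RRs: "R k \<omega> \<le> Rs \<omega>" for k \<omega>
    unfolding Rs_def R_sum by (rule sum_le_suminf) auto
  have GGs: "G k p \<le> Gs p" for k p
    unfolding Gs_def G_sum by (rule sum_le_suminf) auto
  have Rs1: "Rs \<omega> \<le> 1" for \<omega>
    unfolding Rs_def by (rule suminf_le_const) (use R1 in \<open>auto simp: R_sum\<close>)
  have Gs1: "Gs p \<le> 1" for p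
    unfolding Gs_def by (rule suminf_le_const) (use G1 in \<open>auto simp: G_sum\<close>)

  have E_eq: "emeasure E C = (\<integral>\<^sup>+\<omega>. emeasure U (Pair (v \<omega>) -` C) \<partial>D)" if C: "C \<in> sets (N \<Otimes>\<^sub>M U)" for C
  proof -
    have C': "C \<in> sets (distr D N v \<Otimes>\<^sub>M U)" using C by (simp cong: sets_pair_measure_cong)
    show ?thesis
      unfolding E_def U.emeasure_pair_measure_alt[OF C']
      by (rule nn_integral_distr[OF v]) (use U.measurable_emeasure_Pair[OF C] in simp)
  qed
  \<comment> \<open>An \<open>E\<close>-null set has almost surely null sections at
    \<open>v\<close>, so by saturation no admissible candidate enters it. This makes every
    \<open>\<mu> k\<close> absolutely continuous with respect to \<open>E\<close>.\<close>
  have null: "AE \<omega> in D. \<forall>k. V k \<omega> \<longrightarrow> z k \<omega> \<notin> C" if C: "C \<in> sets (N \<Otimes>\<^sub>M U)" "emeasure E C = 0" for C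
  proof -
    have "(\<lambda>\<omega>. emeasure U (Pair (v \<omega>) -` C)) \<in> borel_measurable D"
      by (rule measurable_compose[OF v U.measurable_emeasure_Pair[OF C(1)]])
    then have "AE \<omega> in D. emeasure U (Pair (v \<omega>) -` C) = 0"
      using C(2) unfolding E_eq[OF C(1)] by (subst (asm) nn_integral_0_iff_AE) auto
    with sat[OF C(1)] show ?thesis by eventually_elim (auto simp: z_def)
  qed
  have dens: "density E (g k) = \<mu> k" for k
    unfolding g_def
  proof (rule E.density_RN_deriv)
    show "absolutely_continuous E (\<mu> k)"
      unfolding absolutely_continuous_def
    proof
      fix C assume "C \<in> null_sets E"
      then have C: "C \<in> sets (N \<Otimes>\<^sub>M U)" "C \<in> sets E" "emeasure E C = 0" by (auto simp: sE)
      have "emeasure (\<mu> k) C = (\<integral>\<^sup>+\<omega>. (1 - R k \<omega>) * indicator {\<omega>. V k \<omega>} \<omega> * indicator (z k -` C \<inter> space D) \<omega> \<partial>D)"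
        unfolding \<mu>_def using C(2) by (subst emeasure_distr) (auto simp: emeasure_density)
      also have "\<dots> = (\<integral>\<^sup>+\<omega>. 0 \<partial>D)"
        by (rule nn_integral_cong_AE) (use null[OF C(1,3)] in \<open>eventually_elim, auto simp: indicator_def\<close>)
      finally show "C \<in> null_sets (\<mu> k)" using C(2) by (auto simp: \<mu>_def)
    qed
  qed (simp add: \<mu>_def)
  have change: "(\<integral>\<^sup>+\<omega>. (1 - R k \<omega>) * indicator {\<omega>. V k \<omega>} \<omega> * f (z k \<omega>) \<partial>D) = (\<integral>\<^sup>+p. g k p * f p \<partial>E)"
    if [measurable]: "f \<in> borel_measurable E" for f k
  proof -
    have "(\<integral>\<^sup>+p. g k p * f p \<partial>E) = integral\<^sup>N (\<mu> k) f"
      unfolding dens[symmetric] by (simp add: nn_integral_density)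
    also have "\<dots> = (\<integral>\<^sup>+\<omega>. (1 - R k \<omega>) * indicator {\<omega>. V k \<omega>} \<omega> * f (z k \<omega>) \<partial>D)"
      unfolding \<mu>_def by (subst nn_integral_distr) (auto simp: nn_integral_density)
    finally show ?thesis by simp
  qed
  have total: "(\<Sum>k. \<integral>\<^sup>+\<omega>. w k \<omega> * indicator C (z k \<omega>) \<partial>D) = (\<integral>\<^sup>+p. Gs p * indicator C p \<partial>E)"
    if [measurable]: "C \<in> sets E" for C
  proof -
    have "(\<integral>\<^sup>+\<omega>. w k \<omega> * indicator C (z k \<omega>) \<partial>D) = (\<integral>\<^sup>+p. a k p * g k p * indicator C p \<partial>E)" for k
      using change[of "\<lambda>p. a k p * indicator C p" k] by (simp add: w_def mult_ac)
    then show ?thesis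
      unfolding Gs_def by (simp add: nn_integral_suminf[symmetric])
  qed
  \<comment> \<open>The mass accepted while \<open>v\<close> is in \<open>A\<close> equals the mass
    of \<open>E\<close> covered above \<open>A\<close>. As \<open>v\<close> and the first marginal
    of \<open>E\<close> have the same law, the two deficits agree as well.\<close>
  have balance: "(\<integral>\<^sup>+\<omega>. (1 - Rs \<omega>) * indicator A (v \<omega>) \<partial>D) =
      (\<integral>\<^sup>+p. (1 - Gs p) * indicator (A \<times> space U) p \<partial>E)" if [measurable]: "A \<in> sets N" for A
  proof -
    have "(\<integral>\<^sup>+\<omega>. Rs \<omega> * indicator A (v \<omega>) \<partial>D) = (\<Sum>k. \<integral>\<^sup>+\<omega>. w k \<omega> * indicator (A \<times> space U) (z k \<omega>) \<partial>D)"
      unfolding Rs_def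
      by (subst nn_integral_suminf[symmetric])
         (auto intro!: nn_integral_cong simp: z_def indicator_times measurable_space[OF X])
    also have "\<dots> = (\<integral>\<^sup>+p. Gs p * indicator (A \<times> space U) p \<partial>E)"
      by (rule total) measurable
    finally have eq: "(\<integral>\<^sup>+\<omega>. Rs \<omega> * indicator A (v \<omega>) \<partial>D) = (\<integral>\<^sup>+p. Gs p * indicator (A \<times> space U) p \<partial>E)" .
    have "(\<integral>\<^sup>+\<omega>. Rs \<omega> * indicator A (v \<omega>) \<partial>D) + (\<integral>\<^sup>+\<omega>. (1 - Rs \<omega>) * indicator A (v \<omega>) \<partial>D) =
        (\<integral>\<^sup>+\<omega>. indicator A (v \<omega>) \<partial>D)"
      by (subst nn_integral_add[symmetric])
         (auto intro!: nn_integral_cong simp: distrib_right[symmetric] add_diff_inverse_ennreal[OF Rs1])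
    also have "\<dots> = emeasure (distr D N v) A"
      by (subst nn_integral_distr[OF v, symmetric]) auto
    also have "\<dots> = emeasure E (A \<times> space U)"
      unfolding E_def by (subst U.emeasure_pair_measure_Times) (auto simp: U.emeasure_space_1)
    also have "\<dots> = (\<integral>\<^sup>+p. indicator (A \<times> space U) p \<partial>E)"
      by (rule nn_integral_indicator[symmetric]) measurable
    also have "\<dots> = (\<integral>\<^sup>+p. Gs p * indicator (A \<times> space U) p \<partial>E) + (\<integral>\<^sup>+p. (1 - Gs p) * indicator (A \<times> space U) p \<partial>E)"
      by (subst nn_integral_add[symmetric])
         (auto intro!: nn_integral_cong simp: distrib_right[symmetric] add_diff_inverse_ennreal[OF Gs1])
    finally have sums: "(\<integral>\<^sup>+p. Gs p * indicator (A \<times> space U) p \<partial>E) + (\<integral>\<^sup>+\<omega>. (1 - Rs \<omega>) * indicator A (v \<omega>) \<partial>D)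
      = (\<integral>\<^sup>+p. Gs p * indicator (A \<times> space U) p \<partial>E) + (\<integral>\<^sup>+p. (1 - Gs p) * indicator (A \<times> space U) p \<partial>E)"
      unfolding eq .
    have "(\<integral>\<^sup>+p. Gs p * indicator (A \<times> space U) p \<partial>E) \<le> (\<integral>\<^sup>+p. 1 \<partial>E)"
      by (rule nn_integral_mono) (use Gs1 in \<open>auto simp: indicator_def\<close>)
    then have "(\<integral>\<^sup>+p. Gs p * indicator (A \<times> space U) p \<partial>E) < top"
      by (simp add: E.emeasure_space_1 less_top[symmetric] top_unique) (auto simp: top_unique)
    with sums show ?thesis by (auto simp: ennreal_add_left_cancel)
  qed

  \<comment> \<open>Where \<open>g k\<close> is infinite, \<open>a k * g k\<close> would vanish
    instead of filling up the density; this case is shown to be negligible.\<close>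
  have g_fin: "AE p in E. \<forall>k. g k p < top"
  proof (subst AE_all_countable, intro allI)
    fix k
    have "(\<integral>\<^sup>+p. g k p \<partial>E) = (\<integral>\<^sup>+\<omega>. (1 - R k \<omega>) * indicator {\<omega>. V k \<omega>} \<omega> \<partial>D)"
      using change[of "\<lambda>_. 1" k] by simp
    also have "\<dots> \<le> (\<integral>\<^sup>+\<omega>. 1 \<partial>D)"
      by (intro nn_integral_mono) (auto simp: indicator_def)
    finally have "(\<integral>\<^sup>+p. g k p \<partial>E) \<le> (\<integral>\<^sup>+\<omega>. 1 \<partial>D)" .
    then have "(\<integral>\<^sup>+p. g k p \<partial>E) \<noteq> \<infinity>" by (auto simp: D.emeasure_space_1 top_unique)
    from nn_integral_PInf_AE[OF g this] show "AE p in E. g k p < top" by (simp add: less_top)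
  qed
  \<comment> \<open>The part of the target that is not fully covered by the whole procedure.\<close>
  define C where "C = {p \<in> space E. Gs p < 1 \<and> (\<forall>k. g k p < top)}"
  have C_E [measurable]: "C \<in> sets E" unfolding C_def by measurable
  then have C: "C \<in> sets (N \<Otimes>\<^sub>M U)" by (simp add: sE)
  \<comment> \<open>At an admissible candidate one of two things happens: \<open>a k = 1\<close>,
    and then \<open>R\<close> reaches 1 for this sample point; or \<open>a k < 1\<close>, and then
    \<open>a k * g k\<close> equals the whole remaining room, so \<open>G\<close> reaches 1 at this
    pair.\<close>
  have avoid: "z k \<omega> \<notin> C" if "Rs \<omega> < 1" "V k \<omega>" for k \<omega>
  proof
    let ?p = "z k \<omega>"
    assume "?p \<in> C"
    then have p: "Gs ?p < 1" "g k ?p < top" by (auto simp: C_def)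
    have "a k ?p \<noteq> 1"
    proof
      assume "a k ?p = 1"
      then have "R (Suc k) \<omega> = R k \<omega> + (1 - R k \<omega>)" using that(2) by (simp add: RS w_def)
      also have "\<dots> = 1" using R1 by (rule add_diff_inverse_ennreal)
      finally show False using RRs[of "Suc k" \<omega>] that(1) by simp
    qed
    then have less: "(1 - G k ?p) / g k ?p < 1" and aeq: "a k ?p = (1 - G k ?p) / g k ?p"
      by (auto simp: a_def min_def not_le split: if_splits)
    have "G k ?p < 1" using GGs[of k ?p] p(1) by (rule le_less_trans)
    then have "1 - G k ?p \<noteq> 0" by (simp add: diff_eq_0_iff_ennreal)
    then have "g k ?p \<noteq> 0" using less by (auto simp: ennreal_divide_zero)
    then have "a k ?p * g k ?p = 1 - G k ?p"
      using p(2) by (simp add: aeq ennreal_divide_times)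
    then have "G (Suc k) ?p = G k ?p + (1 - G k ?p)" by (simp add: GS)
    also have "\<dots> = 1" using G1 by (rule add_diff_inverse_ennreal)
    finally show False using GGs[of "Suc k" ?p] p(1) by simp
  qed
  \<comment> \<open>If acceptance may fail, no admissible candidate lies in \<open>C\<close>, so
    saturation forces \<open>v\<close> into \<open>A\<close>. Above \<open>A\<close> the set
    \<open>C\<close> is \<open>E\<close>-null, that is, the target is fully covered there, and
    \<open>balance\<close> turns this into certain acceptance for \<open>v\<close> in
    \<open>A\<close>. Hence acceptance is almost surely certain.\<close>
  define A where "A = {x \<in> space N. emeasure U (Pair x -` C) = 0}"
  have A [measurable]: "A \<in> sets N"
    unfolding A_def using U.measurable_emeasure_Pair[OF C] by measurable
  have vA: "AE \<omega> in D. Rs \<omega> < 1 \<longrightarrow> v \<omega> \<in> A"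
    using sat[OF C] AE_space
    by eventually_elim (use avoid measurable_space[OF v] in \<open>auto simp: A_def z_def\<close>)
  have "emeasure E (C \<inter> (A \<times> space U)) = 0"
  proof -
    have "C \<inter> (A \<times> space U) \<in> sets (N \<Otimes>\<^sub>M U)" using C A by auto
    moreover have "emeasure U (Pair (v \<omega>) -` (C \<inter> (A \<times> space U))) = 0" for \<omega>
    proof (cases "v \<omega> \<in> A")
      case True
      have "emeasure U (Pair (v \<omega>) -` (C \<inter> (A \<times> space U))) \<le> emeasure U (Pair (v \<omega>) -` C)"
        using sets_Pair1[OF C] by (intro emeasure_mono) auto
      then show ?thesis using True by (simp add: A_def)
    next
      case False
      then have "Pair (v \<omega>) -` (C \<inter> (A \<times> space U)) = {}" by auto
      then show ?thesis by simp
    qed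
    ultimately show ?thesis by (simp add: E_eq)
  qed
  then have "AE p in E. p \<notin> C \<inter> (A \<times> space U)"
    by (intro AE_not_in null_setsI) measurable
  with g_fin AE_space[of E] have "AE p in E. (1 - Gs p) * indicator (A \<times> space U) p = 0"
    by eventually_elim (use Gs1 in \<open>auto simp: C_def indicator_def diff_eq_0_iff_ennreal not_less\<close>)
  then have "(\<integral>\<^sup>+p. (1 - Gs p) * indicator (A \<times> space U) p \<partial>E) = 0"
    by (subst nn_integral_0_iff_AE) auto
  then have "(\<integral>\<^sup>+\<omega>. (1 - Rs \<omega>) * indicator A (v \<omega>) \<partial>D) = 0" by (simp add: balance)
  then have "AE \<omega> in D. (1 - Rs \<omega>) * indicator A (v \<omega>) = 0" by (subst (asm) nn_integral_0_iff_AE) auto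
  with vA have Rs_1: "AE \<omega> in D. Rs \<omega> = 1"
    by eventually_elim (use Rs1 in \<open>auto simp: diff_eq_0_iff_ennreal indicator_def intro!: antisym split: if_splits simp: not_less[symmetric]\<close>)
  \<comment> \<open>Now \<open>balance\<close> is read in the other direction, over the whole space:
    certain acceptance implies that the target is covered completely.\<close>
  have "(\<integral>\<^sup>+p. (1 - Gs p) * indicator (space N \<times> space U) p \<partial>E) = (\<integral>\<^sup>+\<omega>. (1 - Rs \<omega>) * indicator (space N) (v \<omega>) \<partial>D)"
    by (rule balance[symmetric]) auto
  also have "\<dots> = (\<integral>\<^sup>+\<omega>. 0 \<partial>D)"
    by (rule nn_integral_cong_AE) (use Rs_1 in \<open>eventually_elim, auto\<close>)
  finally have "(\<integral>\<^sup>+p. (1 - Gs p) * indicator (space N \<times> space U) p \<partial>E) = 0" by simp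
  then have "AE p in E. (1 - Gs p) * indicator (space N \<times> space U) p = 0"
    by (subst (asm) nn_integral_0_iff_AE) auto
  then have Gs_1: "AE p in E. Gs p = 1"
    using AE_space[of E]
    by eventually_elim
      (use Gs1 in \<open>auto simp: E_def space_pair_measure diff_eq_0_iff_ennreal intro!: antisym\<close>)
  show ?thesis
  proof (rule that[OF w])
    show "w k \<omega> = 0" if "\<not> V k \<omega>" for k \<omega> using that by (simp add: w_def)
    show "AE \<omega> in D. (\<Sum>k. w k \<omega>) = 1" using Rs_1 by (simp add: Rs_def)
    fix C assume "C \<in> sets (N \<Otimes>\<^sub>M U)"
    then have [measurable]: "C \<in> sets E" by (simp add: sE)
    have "(\<Sum>k. \<integral>\<^sup>+\<omega>. w k \<omega> * indicator C (v \<omega>, X k \<omega>) \<partial>D) = (\<integral>\<^sup>+p. Gs p * indicator C p \<partial>E)"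
      using total[of C] by (simp add: z_def)
    also have "\<dots> = (\<integral>\<^sup>+p. indicator C p \<partial>E)"
      by (rule nn_integral_cong_AE) (use Gs_1 in \<open>eventually_elim, auto\<close>)
    also have "\<dots> = emeasure E C" by (rule nn_integral_indicator) measurable
    finally show "(\<Sum>k. \<integral>\<^sup>+\<omega>. w k \<omega> * indicator C (v \<omega>, X k \<omega>) \<partial>D) = emeasure (distr D N v \<Otimes>\<^sub>M U) C"
      by (simp add: E_def)
  qed
qed

lemma emeasure_unit_uniform_between:
  fixes a b :: ennreal
  assumes "a \<le> b" "b \<le> 1"
  shows "emeasure unit_uniform {t. a \<le> ennreal t \<and> ennreal t < b} = b - a"
proof -
  obtain r s where rs: "a = ennreal r" "b = ennreal s" "0 \<le> r" "0 \<le> s"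
    using assms by (metis ennreal_cases ennreal_one_neq_top neq_top_trans)
  have "r \<le> s" "s \<le> 1" using assms rs by (auto simp: ennreal_le_iff)
  have "emeasure unit_uniform {t. a \<le> ennreal t \<and> ennreal t < b}
      = emeasure lborel ({0<..<1} \<inter> {t. a \<le> ennreal t \<and> ennreal t < b})"
    by (subst emeasure_uniform_measure) (auto simp: divide_ennreal_def)
  also have "\<dots> = emeasure lborel {max 0 r..<s}"
  proof (rule emeasure_eq_AE)
    show "AE t in lborel. t \<in> {0<..<1} \<inter> {t. a \<le> ennreal t \<and> ennreal t < b} \<longleftrightarrow> t \<in> {max 0 r..<s}"
      using AE_lborel_singleton[of 0]
      by eventually_elim (use rs \<open>s \<le> 1\<close> in \<open>auto simp: ennreal_le_iff ennreal_less_iff\<close>)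
  qed auto
  also have "\<dots> = b - a" using rs \<open>r \<le> s\<close> by (simp add: ennreal_minus max_def)
  finally show ?thesis .
qed

lemma AE_unit_uniform: "AE t in unit_uniform. t \<in> {0<..<1}"
  by (rule AE_uniform_measureI) auto

text \<open>Realizes the weights by one external uniform variable: the unit interval is cut into
  consecutive intervals of lengths \<open>w k\<close>, and \<open>K\<close> is the index of the one
  containing the variable.\<close>

lemma selection_index:
  fixes D :: "'a measure" and N :: "'b measure" and U :: "'c measure"
  assumes D: "prob_space D" and U: "prob_space U"
    and v [measurable]: "v \<in> measurable D N"
    and X [measurable]: "\<And>k. X k \<in> measurable D U"
    and V [measurable]: "\<And>k. Measurable.pred D (V k)"
    and sat: "\<And>C. C \<in> sets (N \<Otimes>\<^sub>M U) \<Longrightarrow>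
      AE \<omega> in D. emeasure U (Pair (v \<omega>) -` C) \<noteq> 0 \<longleftrightarrow> (\<exists>k. V k \<omega> \<and> (v \<omega>, X k \<omega>) \<in> C)"
  obtains K :: "'a \<times> real \<Rightarrow> nat"
  where "K \<in> measurable (D \<Otimes>\<^sub>M unit_uniform) (count_space UNIV)"
    "AE p in D \<Otimes>\<^sub>M unit_uniform. V (K p) (fst p)"
    "distr (D \<Otimes>\<^sub>M unit_uniform) (N \<Otimes>\<^sub>M U) (\<lambda>p. (v (fst p), X (K p) (fst p))) = distr D N v \<Otimes>\<^sub>M U"
proof -
  interpret D: prob_space D by fact
  interpret U: prob_space U by fact
  interpret T: prob_space unit_uniform by (rule prob_space_unit_uniform)
  interpret DT: pair_prob_space D unit_uniform ..
  interpret L: prob_space "distr D N v" by (rule D.prob_space_distr) fact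
  obtain w :: "nat \<Rightarrow> 'a \<Rightarrow> ennreal" where w [measurable]: "\<And>k. w k \<in> borel_measurable D"
    and w0: "\<And>k \<omega>. \<not> V k \<omega> \<Longrightarrow> w k \<omega> = 0" and w1: "AE \<omega> in D. (\<Sum>k. w k \<omega>) = 1"
    and w_law: "\<And>C. C \<in> sets (N \<Otimes>\<^sub>M U) \<Longrightarrow>
      (\<Sum>k. \<integral>\<^sup>+\<omega>. w k \<omega> * indicator C (v \<omega>, X k \<omega>) \<partial>D) = emeasure (distr D N v \<Otimes>\<^sub>M U) C"
    using selection_weights[OF assms] by blast
  define W where "W k \<omega> = (\<Sum>j<k. w j \<omega>)" for k \<omega>
  have [measurable]: "W k \<in> borel_measurable D" for k unfolding W_def by measurable
  have W_mono: "W j \<omega> \<le> W k \<omega>" if "j \<le> k" for j k \<omega>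
    unfolding W_def using that by (intro sum_mono2) auto
  \<comment> \<open>\<open>Suc k\<close> because \<open>W\<close> sums the weights strictly below
    its index, so the interval of \<open>k\<close> runs from \<open>W k\<close> to
    \<open>W (Suc k)\<close>. Where the weights do not sum to 1, the value may be arbitrary; this
    happens with probability 0.\<close>
  define K where "K p = (LEAST k. ennreal (snd p) < W (Suc k) (fst p))" for p
  have K [measurable]: "K \<in> measurable (D \<Otimes>\<^sub>M unit_uniform) (count_space UNIV)"
    unfolding K_def by measurable
  have K_iff: "K (\<omega>, t) = k \<longleftrightarrow> W k \<omega> \<le> ennreal t \<and> ennreal t < W (Suc k) \<omega>"
    if s: "(\<Sum>k. w k \<omega>) = 1" and t: "t \<in> {0<..<1}" for \<omega> t k
  proof -
    have "(\<lambda>k. W k \<omega>) \<longlonglongrightarrow> 1"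
      using summable_LIMSEQ[of "\<lambda>k. w k \<omega>"] s by (simp add: W_def)
    moreover have "ennreal t < 1" using t by simp
    ultimately have "eventually (\<lambda>k. ennreal t < W k \<omega>) sequentially" by (rule order_tendstoD)
    then obtain n where "ennreal t < W n \<omega>" by (auto simp: eventually_sequentially)
    then have "ennreal t < W (Suc n) \<omega>" using W_mono[of n "Suc n" \<omega>] by (auto intro: less_le_trans)
    then have 1: "ennreal t < W (Suc (K (\<omega>, t))) \<omega>"
      unfolding K_def fst_conv snd_conv by (rule LeastI)
    have 2: "W (K (\<omega>, t)) \<omega> \<le> ennreal t"
    proof (cases "K (\<omega>, t)")
      case (Suc j)
      then have "\<not> ennreal t < W (Suc j) \<omega>"
        unfolding K_def fst_conv snd_conv by (intro not_less_Least) auto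
      then show ?thesis by (simp add: Suc not_less)
    qed (simp add: W_def)
    show ?thesis
    proof
      assume k: "W k \<omega> \<le> ennreal t \<and> ennreal t < W (Suc k) \<omega>"
      have "\<not> Suc k \<le> K (\<omega>, t)"
      proof
        assume "Suc k \<le> K (\<omega>, t)"
        from W_mono[OF this, of \<omega>] k 2 show False by auto
      qed
      moreover have "\<not> Suc (K (\<omega>, t)) \<le> k"
      proof
        assume "Suc (K (\<omega>, t)) \<le> k"
        from W_mono[OF this, of \<omega>] k 1 show False by auto
      qed
      ultimately show "K (\<omega>, t) = k" by auto
    qed (use 1 2 in auto)
  qed
  have K_law: "emeasure unit_uniform {t. K (\<omega>, t) = k} = w k \<omega>"
    if s: "(\<Sum>k. w k \<omega>) = 1" and \<omega>: "\<omega> \<in> space D" for \<omega> k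
  proof -
    have "(\<lambda>t. K (\<omega>, t)) \<in> measurable unit_uniform (count_space UNIV)"
      by (rule measurable_compose[OF measurable_Pair1'[OF \<omega>] K])
    then have "{t \<in> space unit_uniform. K (\<omega>, t) = k} \<in> sets unit_uniform" by measurable
    then have "{t. K (\<omega>, t) = k} \<in> sets borel" by simp
    moreover have "{t. W k \<omega> \<le> ennreal t \<and> ennreal t < W (Suc k) \<omega>} \<in> sets borel" by measurable
    ultimately have "emeasure unit_uniform {t. K (\<omega>, t) = k}
        = emeasure unit_uniform {t. W k \<omega> \<le> ennreal t \<and> ennreal t < W (Suc k) \<omega>}"
      by (intro emeasure_eq_AE eventually_mono[OF AE_unit_uniform]) (auto simp: K_iff[OF s])
    also have "\<dots> = W (Suc k) \<omega> - W k \<omega>"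
    proof (rule emeasure_unit_uniform_between)
      have "W (Suc k) \<omega> \<le> (\<Sum>k. w k \<omega>)" unfolding W_def by (rule sum_le_suminf) auto
      then show "W (Suc k) \<omega> \<le> 1" by (simp add: s)
    qed (rule W_mono, simp)
    also have "\<dots> = w k \<omega>"
    proof -
      have "W k \<omega> \<le> (\<Sum>k. w k \<omega>)" unfolding W_def by (rule sum_le_suminf) auto
      then have "W k \<omega> \<noteq> top" by (auto simp: s top_unique)
      then show ?thesis by (simp add: W_def)
    qed
    finally show ?thesis .
  qed
  show ?thesis
  proof (rule that[OF K])
    have VK: "{p \<in> space (D \<Otimes>\<^sub>M unit_uniform). V (K p) (fst p)} \<in> sets (D \<Otimes>\<^sub>M unit_uniform)"
      by measurable
    show "AE p in D \<Otimes>\<^sub>M unit_uniform. V (K p) (fst p)"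
    proof (rule DT.AE_pair_measure[OF VK])
      show "AE \<omega> in D. AE t in unit_uniform. V (K (\<omega>, t)) (fst (\<omega>, t))"
        using w1
      proof eventually_elim
        case (elim \<omega>)
        show ?case
          using AE_unit_uniform
        proof eventually_elim
          case (elim t)
          have "W (K (\<omega>, t)) \<omega> < W (Suc (K (\<omega>, t))) \<omega>"
            using K_iff[OF \<open>(\<Sum>k. w k \<omega>) = 1\<close> elim, of "K (\<omega>, t)"] by auto
          \<comment> \<open>The chosen interval is nonempty, so its weight is positive, and weights
            vanish at inadmissible indices.\<close>
          then have "w (K (\<omega>, t)) \<omega> \<noteq> 0" by (auto simp: W_def)
          then show ?case using w0 by auto
        qed
      qed
    qed
    show "distr (D \<Otimes>\<^sub>M unit_uniform) (N \<Otimes>\<^sub>M U) (\<lambda>p. (v (fst p), X (K p) (fst p))) = distr D N v \<Otimes>\<^sub>M U"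
    proof (rule measure_eqI)
      fix C assume "C \<in> sets (distr (D \<Otimes>\<^sub>M unit_uniform) (N \<Otimes>\<^sub>M U) (\<lambda>p. (v (fst p), X (K p) (fst p))))"
      then have C [measurable]: "C \<in> sets (N \<Otimes>\<^sub>M U)" by simp
      have "emeasure (distr (D \<Otimes>\<^sub>M unit_uniform) (N \<Otimes>\<^sub>M U) (\<lambda>p. (v (fst p), X (K p) (fst p)))) C
          = (\<integral>\<^sup>+p. indicator C (v (fst p), X (K p) (fst p)) \<partial>(D \<Otimes>\<^sub>M unit_uniform))"
        by (subst nn_integral_indicator[symmetric], simp, subst nn_integral_distr) auto
      also have "\<dots> = (\<integral>\<^sup>+\<omega>. \<integral>\<^sup>+t. indicator C (v \<omega>, X (K (\<omega>, t)) \<omega>) \<partial>unit_uniform \<partial>D)"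
        by (subst T.nn_integral_fst[symmetric]) auto
      also have "\<dots> = (\<integral>\<^sup>+\<omega>. (\<Sum>k. w k \<omega> * indicator C (v \<omega>, X k \<omega>)) \<partial>D)"
      proof (rule nn_integral_cong_AE)
        show "AE \<omega> in D. (\<integral>\<^sup>+t. indicator C (v \<omega>, X (K (\<omega>, t)) \<omega>) \<partial>unit_uniform) =
            (\<Sum>k. w k \<omega> * indicator C (v \<omega>, X k \<omega>))"
          using w1 AE_space
        proof eventually_elim
          case (elim \<omega>)
          have [measurable]: "(\<lambda>t. K (\<omega>, t)) \<in> measurable unit_uniform (count_space UNIV)"
            by (rule measurable_compose[OF measurable_Pair1'[OF elim(2)] K])
          have sets: "{t. K (\<omega>, t) = k} \<in> sets unit_uniform" for k
          proof -
            have "{t \<in> space unit_uniform. K (\<omega>, t) = k} \<in> sets unit_uniform" by measurable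
            then show ?thesis by simp
          qed
          have "(\<Sum>k. indicator C (v \<omega>, X k \<omega>) * indicator {t. K (\<omega>, t) = k} t) =
              (indicator C (v \<omega>, X (K (\<omega>, t)) \<omega>) :: ennreal)" for t
            by (subst suminf_finite[of "{K (\<omega>, t)}"]) auto
          then have "(\<integral>\<^sup>+t. indicator C (v \<omega>, X (K (\<omega>, t)) \<omega>) \<partial>unit_uniform) =
              (\<integral>\<^sup>+t. (\<Sum>k. indicator C (v \<omega>, X k \<omega>) * indicator {t. K (\<omega>, t) = k} t) \<partial>unit_uniform)"
            by simp
          also have "\<dots> = (\<Sum>k. \<integral>\<^sup>+t. indicator C (v \<omega>, X k \<omega>) * indicator {t. K (\<omega>, t) = k} t \<partial>unit_uniform)"
            by (rule nn_integral_suminf) (use sets in auto)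
          also have "\<dots> = (\<Sum>k. w k \<omega> * indicator C (v \<omega>, X k \<omega>))"
            by (subst nn_integral_cmult_indicator[OF sets]) (simp add: K_law[OF elim] mult.commute)
          finally show ?case .
        qed
      qed
      also have "\<dots> = emeasure (distr D N v \<Otimes>\<^sub>M U) C"
        by (subst nn_integral_suminf) (auto simp: w_law[OF C])
      finally show "emeasure (distr (D \<Otimes>\<^sub>M unit_uniform) (N \<Otimes>\<^sub>M U) (\<lambda>p. (v (fst p), X (K p) (fst p)))) C
          = emeasure (distr D N v \<Otimes>\<^sub>M U) C" .
    qed (auto cong: sets_pair_measure_cong)
  qed
qed

lemma fresh_coordinate_independent:
  fixes S :: "'a measure" and U :: "'u measure" and L :: "'l measure"
  assumes S: "prob_space S" and U: "prob_space U"
    and h [measurable]: "h \<in> measurable (S \<Otimes>\<^sub>M PiM UNIV (\<lambda>_. U)) L"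
    and dep: "\<And>x \<tau> \<tau>'. h (x, comb_seq n \<tau> \<tau>') = h (x, \<tau>)"
  shows "distr (S \<Otimes>\<^sub>M PiM UNIV (\<lambda>_. U)) (L \<Otimes>\<^sub>M U) (\<lambda>\<omega>. (h \<omega>, snd \<omega> n))
    = distr (S \<Otimes>\<^sub>M PiM UNIV (\<lambda>_. U)) L h \<Otimes>\<^sub>M U"
proof -
  let ?T = "PiM UNIV (\<lambda>_::nat. U)"
  interpret S: prob_space S by fact
  interpret U: prob_space U by fact
  interpret sequence_space U ..
  have T: "prob_space ?T" by (rule prob_space_PiM) (rule U)
  interpret T: prob_space ?T by (rule T)
  note nn_integral_fst_seq = sigma_finite_measure.nn_integral_fst[OF prob_space_imp_sigma_finite[OF T]]
  interpret ST: pair_prob_space S ?T ..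
  interpret TT: pair_prob_space ?T ?T ..
  interpret H: prob_space "distr (S \<Otimes>\<^sub>M ?T) L h" by (rule ST.P.prob_space_distr) fact
  show ?thesis
  proof (rule measure_eqI)
    fix A assume "A \<in> sets (distr (S \<Otimes>\<^sub>M ?T) (L \<Otimes>\<^sub>M U) (\<lambda>\<omega>. (h \<omega>, snd \<omega> n)))"
    then have A [measurable]: "A \<in> sets (L \<Otimes>\<^sub>M U)" by simp
    have "emeasure (distr (S \<Otimes>\<^sub>M ?T) (L \<Otimes>\<^sub>M U) (\<lambda>\<omega>. (h \<omega>, snd \<omega> n))) A
        = (\<integral>\<^sup>+\<omega>. indicator A (h \<omega>, snd \<omega> n) \<partial>(S \<Otimes>\<^sub>M ?T))"
      by (subst nn_integral_indicator[symmetric], simp, subst nn_integral_distr) auto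
    also have "\<dots> = (\<integral>\<^sup>+x. \<integral>\<^sup>+\<tau>. indicator A (h (x, \<tau>), \<tau> n) \<partial>?T \<partial>S)"
      by (subst nn_integral_fst_seq[symmetric]) auto
    also have "\<dots> = (\<integral>\<^sup>+x. \<integral>\<^sup>+\<tau>. emeasure U (Pair (h (x, \<tau>)) -` A) \<partial>?T \<partial>S)"
    proof (rule nn_integral_cong)
      fix x assume x: "x \<in> space S"
      have [measurable]: "(\<lambda>\<tau>. h (x, \<tau>)) \<in> measurable ?T L"
        by (rule measurable_compose[OF measurable_Pair1'[OF x] h])
      \<comment> \<open>Joining the first \<open>n\<close> coordinates of one sequence to a second,
        independent sequence preserves the law. Under \<open>comb_seq n\<close> the value of
        \<open>h\<close> still comes from \<open>\<tau>\<close>, whereas coordinate \<open>n\<close>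
        becomes coordinate 0 of \<open>\<tau>'\<close>.\<close>
      have "(\<integral>\<^sup>+\<tau>. indicator A (h (x, \<tau>), \<tau> n) \<partial>?T) =
          (\<integral>\<^sup>+\<tau>. indicator A (h (x, \<tau>), \<tau> n) \<partial>(distr (?T \<Otimes>\<^sub>M ?T) ?T (\<lambda>(\<tau>, \<tau>'). comb_seq n \<tau> \<tau>')))"
        by (simp add: PiM_comb_seq)
      also have "\<dots> = (\<integral>\<^sup>+p. indicator A (h (x, fst p), snd p 0) \<partial>(?T \<Otimes>\<^sub>M ?T))"
        by (subst nn_integral_distr) (auto simp: split_beta' dep comb_seq_add[of n _ _ 0, simplified])
      also have "\<dots> = (\<integral>\<^sup>+\<tau>. \<integral>\<^sup>+\<tau>'. indicator A (h (x, \<tau>), \<tau>' 0) \<partial>?T \<partial>?T)"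
        by (subst nn_integral_fst_seq[symmetric]) auto
      also have "\<dots> = (\<integral>\<^sup>+\<tau>. emeasure U (Pair (h (x, \<tau>)) -` A) \<partial>?T)"
      proof (rule nn_integral_cong)
        fix \<tau> assume \<tau>: "\<tau> \<in> space ?T"
        have hx: "h (x, \<tau>) \<in> space L" by (rule measurable_space[OF h]) (use x \<tau> in \<open>auto simp: space_pair_measure\<close>)
        have [measurable]: "Pair (h (x, \<tau>)) -` A \<in> sets U" by (rule sets_Pair1[OF A])
        have "(\<integral>\<^sup>+\<tau>'. indicator A (h (x, \<tau>), \<tau>' 0) \<partial>?T) = (\<integral>\<^sup>+\<tau>'. indicator (Pair (h (x, \<tau>)) -` A) (\<tau>' 0) \<partial>?T)"
          by (simp add: indicator_def)
        also have "\<dots> = (\<integral>\<^sup>+u. indicator (Pair (h (x, \<tau>)) -` A) u \<partial>(distr ?T U (\<lambda>\<tau>'. \<tau>' 0)))"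
          by (subst nn_integral_distr) auto
        also have "distr ?T U (\<lambda>\<tau>'. \<tau>' 0) = U" by (rule PiM_component) auto
        finally show "(\<integral>\<^sup>+\<tau>'. indicator A (h (x, \<tau>), \<tau>' 0) \<partial>?T) = emeasure U (Pair (h (x, \<tau>)) -` A)"
          by (simp add: nn_integral_indicator)
      qed
      finally show "(\<integral>\<^sup>+\<tau>. indicator A (h (x, \<tau>), \<tau> n) \<partial>?T) = (\<integral>\<^sup>+\<tau>. emeasure U (Pair (h (x, \<tau>)) -` A) \<partial>?T)" .
    qed
    also have "\<dots> = (\<integral>\<^sup>+\<omega>. emeasure U (Pair (h \<omega>) -` A) \<partial>(S \<Otimes>\<^sub>M ?T))"
      by (rule nn_integral_fst_seq) (rule measurable_compose[OF h U.measurable_emeasure_Pair[OF A]])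
    also have "\<dots> = emeasure (distr (S \<Otimes>\<^sub>M ?T) L h \<Otimes>\<^sub>M U) A"
      by (subst U.emeasure_pair_measure_alt, (simp cong: sets_pair_measure_cong), subst nn_integral_distr[OF h])
         (use U.measurable_emeasure_Pair[OF A] in auto)
    finally show "emeasure (distr (S \<Otimes>\<^sub>M ?T) (L \<Otimes>\<^sub>M U) (\<lambda>\<omega>. (h \<omega>, snd \<omega> n))) A
      = emeasure (distr (S \<Otimes>\<^sub>M ?T) L h \<Otimes>\<^sub>M U) A" .
  qed (auto cong: sets_pair_measure_cong)
qed

section \<open>Sequential enumeration\<close>

lemma measurable_evaluate_at_index:
  fixes f :: "'a \<Rightarrow> nat \<Rightarrow> real"
  assumes f: "f \<in> measurable M real_seqs" and [measurable]: "K \<in> measurable M (count_space UNIV)"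
  shows "(\<lambda>x. f x (K x)) \<in> borel_measurable M"
  using measurable_compose_countable[of "\<lambda>k x. f x k" M borel K] f by measurable

text \<open>One step of the enumeration, for an abstract law \<open>D\<close> of the sequence
  together with the tuple listed so far. The parity of the length decides its kind: a uniform choice
  at even \<open>n\<close>, the first unlisted point at odd \<open>n\<close>.\<close>

lemma next_index:
  assumes S: "prob_space S" "sets S = sets real_seqs" "saturated S"
    and D: "prob_space D" "sets D = sets (S \<Otimes>\<^sub>M real_tuples n)" "distr D S fst = S"
      "AE p in D. snd p ` {..<n} \<subseteq> range (fst p)"
  shows "\<exists>K. K \<in> measurable (D \<Otimes>\<^sub>M unit_uniform) (count_space UNIV) \<and>
    (AE p in D \<Otimes>\<^sub>M unit_uniform. fst (fst p) (K p) \<notin> snd (fst p) ` {..<n}) \<and>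
    (even n \<longrightarrow> distr (D \<Otimes>\<^sub>M unit_uniform) (real_tuples n \<Otimes>\<^sub>M unit_uniform) (\<lambda>p. (snd (fst p), fst (fst p) (K p))) =
       distr D (real_tuples n) snd \<Otimes>\<^sub>M unit_uniform) \<and>
    (odd n \<longrightarrow> K = (\<lambda>p. LEAST k. fst (fst p) k \<notin> snd (fst p) ` {..<n}))"
proof -
  interpret D: prob_space D by fact
  interpret T: prob_space unit_uniform by (rule prob_space_unit_uniform)
  interpret DT: pair_prob_space D unit_uniform ..
  have mfst: "fst \<in> measurable D S" and snd [measurable]: "snd \<in> measurable D (real_tuples n)"
    using measurable_cong_sets[OF D(2) refl] by auto
  have fst [measurable]: "fst \<in> measurable D real_seqs"
    using mfst measurable_cong_sets[OF refl S(2)] by blast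
  have XU: "(\<lambda>p. fst p k) \<in> measurable D unit_uniform" for k
    by (subst measurable_cong_sets[OF refl, of _ borel]) (simp, measurable)
  have V [measurable]: "Measurable.pred D (\<lambda>p. fst p k \<notin> snd p ` {..<n})" for k
  proof -
    have eq: "(\<lambda>p. fst p k \<notin> snd p ` {..<n}) = (\<lambda>p. \<forall>l\<in>{..<n}. fst p k \<noteq> snd p l)"
      by auto
    have "(\<lambda>p. fst p k) \<in> borel_measurable D" by measurable
    moreover have "(\<lambda>p. snd p l) \<in> borel_measurable D" if "l \<in> {..<n}" for l
      using measurable_compose[OF snd measurable_component_singleton[OF that, of "\<lambda>_. borel"]] .
    ultimately show ?thesis
      unfolding eq by (intro pred_intros_finite) measurable
  qed
  have sat: "AE p in D. emeasure unit_uniform (Pair (snd p) -` C) \<noteq> 0 \<longleftrightarrow>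
      (\<exists>k. fst p k \<notin> snd p ` {..<n} \<and> (snd p, fst p k) \<in> C)"
    if "C \<in> sets (real_tuples n \<Otimes>\<^sub>M unit_uniform)" for C
  proof -
    have "C \<in> sets (real_tuples n \<Otimes>\<^sub>M borel)" using that by (simp cong: sets_pair_measure_cong)
    then have "AE x in S. \<forall>v\<in>{..<n} \<rightarrow>\<^sub>E range x. emeasure unit_uniform (Pair v -` C) \<noteq> 0 \<longleftrightarrow>
        (\<exists>k. x k \<notin> v ` {..<n} \<and> (v, x k) \<in> C)"
      using S(3) unfolding saturated_def by blast
    from AE_from_marginal[OF D(3) mfst this] D(4) AE_space[of D]
    show ?thesis
    proof eventually_elim
      case (elim p)
      have "snd p \<in> {..<n} \<rightarrow>\<^sub>E range (fst p)"
        using elim(2) measurable_space[OF snd elim(3)] by (auto simp: space_PiM PiE_iff)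
      with elim(1) show ?case by (rule bspec)
    qed
  qed
  show ?thesis
  proof (cases "even n")
    case True
    obtain K where "K \<in> measurable (D \<Otimes>\<^sub>M unit_uniform) (count_space UNIV)"
      "AE p in D \<Otimes>\<^sub>M unit_uniform. fst (fst p) (K p) \<notin> snd (fst p) ` {..<n}"
      "distr (D \<Otimes>\<^sub>M unit_uniform) (real_tuples n \<Otimes>\<^sub>M unit_uniform) (\<lambda>p. (snd (fst p), fst (fst p) (K p))) =
       distr D (real_tuples n) snd \<Otimes>\<^sub>M unit_uniform"
      by (rule selection_index[OF D(1) prob_space_unit_uniform snd XU V sat])
    with True show ?thesis by blast
  next
    case False
    define K where "K p = (LEAST k. fst (fst p) k \<notin> snd (fst p) ` {..<n})"
      for p :: "((nat \<Rightarrow> real) \<times> (nat \<Rightarrow> real)) \<times> real"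
    have [measurable]: "Measurable.pred (D \<Otimes>\<^sub>M unit_uniform) (\<lambda>p. fst (fst p) k \<notin> snd (fst p) ` {..<n})" for k
      by (rule measurable_compose[OF measurable_fst V])
    have K [measurable]: "K \<in> measurable (D \<Otimes>\<^sub>M unit_uniform) (count_space UNIV)"
      unfolding K_def by measurable
    \<comment> \<open>The full set has sections of measure 1, so saturation provides an unlisted
      point and the \<open>LEAST\<close> is meaningful almost surely.\<close>
    have "space (real_tuples n) \<times> UNIV \<in> sets (real_tuples n \<Otimes>\<^sub>M unit_uniform)" by auto
    from sat[OF this] AE_space[of D] have ex: "AE p in D. \<exists>k. fst p k \<notin> snd p ` {..<n}"
    proof eventually_elim
      case (elim p)
      have "Pair (snd p) -` (space (real_tuples n) \<times> UNIV) = space unit_uniform"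
        using measurable_space[OF snd elim(2)] by auto
      then show ?case using elim(1) T.emeasure_space_1 by auto
    qed
    have "AE p in D \<Otimes>\<^sub>M unit_uniform. fst (fst p) (K p) \<notin> snd (fst p) ` {..<n}"
    proof (rule DT.AE_pair_measure)
      have "(\<lambda>p. fst (fst p) (K p) \<notin> snd (fst p) ` {..<n}) =
          (\<lambda>p. \<forall>k. K p = k \<longrightarrow> fst (fst p) k \<notin> snd (fst p) ` {..<n})" by auto
      moreover have "Measurable.pred (D \<Otimes>\<^sub>M unit_uniform) \<dots>" by measurable
      ultimately show "{p \<in> space (D \<Otimes>\<^sub>M unit_uniform). fst (fst p) (K p) \<notin> snd (fst p) ` {..<n}}
        \<in> sets (D \<Otimes>\<^sub>M unit_uniform)" by (simp add: pred_def)
      show "AE p in D. AE t in unit_uniform. fst (fst (p, t)) (K (p, t)) \<notin> snd (fst (p, t)) ` {..<n}"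
        using ex
      proof eventually_elim
        case (elim p)
        then have "fst p (LEAST k. fst p k \<notin> snd p ` {..<n}) \<notin> snd p ` {..<n}" by (rule LeastI_ex)
        then show ?case unfolding K_def fst_conv by (intro AE_I2)
      qed
    qed
    moreover have "K = (\<lambda>p. LEAST k. fst (fst p) k \<notin> snd (fst p) ` {..<n})" by (simp add: K_def fun_eq_iff)
    ultimately show ?thesis using False K by (intro exI[of _ K] conjI impI) auto
  qed
qed

text \<open>Iterates \<open>next_index\<close>: step \<open>n\<close> is driven by external
  coordinate \<open>n\<close>, while the tuple \<open>H n\<close> depends only on the sequence and
  the earlier coordinates. That coordinate is therefore independent of everything the step looks
  at.\<close>

lemma sequential_enumeration:
  fixes S :: "(nat \<Rightarrow> real) measure"
  assumes S: "prob_space S" "sets S = sets real_seqs" "saturated S"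
  defines "\<Omega> \<equiv> S \<Otimes>\<^sub>M PiM UNIV (\<lambda>_::nat. unit_uniform)"
  obtains H :: "nat \<Rightarrow> (nat \<Rightarrow> real) \<times> (nat \<Rightarrow> real) \<Rightarrow> nat \<Rightarrow> real"
  where "\<And>n. H n \<in> measurable \<Omega> (real_tuples n)"
    "\<And>n l \<omega>. l < n \<Longrightarrow> H (Suc n) \<omega> l = H n \<omega> l"
    "\<And>n. AE \<omega> in \<Omega>. H (Suc n) \<omega> n \<in> range (fst \<omega>) - H n \<omega> ` {..<n}"
    "\<And>n. even n \<Longrightarrow> distr \<Omega> (real_tuples n \<Otimes>\<^sub>M unit_uniform) (\<lambda>\<omega>. (H n \<omega>, H (Suc n) \<omega> n)) =
       distr \<Omega> (real_tuples n) (H n) \<Otimes>\<^sub>M unit_uniform"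
    "\<And>n \<omega>. odd n \<Longrightarrow> H (Suc n) \<omega> n = fst \<omega> (LEAST k. fst \<omega> k \<notin> H n \<omega> ` {..<n})"
proof -
  let ?T = "PiM UNIV (\<lambda>_::nat. unit_uniform)" and ?U = unit_uniform
  interpret S: prob_space S by fact
  interpret U: prob_space ?U by (rule prob_space_unit_uniform)
  interpret T: prob_space ?T by (rule prob_space_PiM) (rule prob_space_unit_uniform)
  interpret ST: pair_prob_space S ?T ..
  interpret \<Omega>: prob_space \<Omega> unfolding \<Omega>_def by (rule ST.P.prob_space_axioms)
  have s\<Omega> [measurable_cong]: "sets \<Omega> = sets (real_seqs \<Otimes>\<^sub>M real_seqs)"
    unfolding \<Omega>_def by (intro sets_pair_measure_cong S(2) sets_PiM_cong) auto
  define good where "good n D K \<longleftrightarrow> K \<in> measurable (D \<Otimes>\<^sub>M ?U) (count_space UNIV) \<and>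
    (AE p in D \<Otimes>\<^sub>M ?U. fst (fst p) (K p) \<notin> snd (fst p) ` {..<n}) \<and>
    (even n \<longrightarrow> distr (D \<Otimes>\<^sub>M ?U) (real_tuples n \<Otimes>\<^sub>M ?U) (\<lambda>p. (snd (fst p), fst (fst p) (K p))) =
       distr D (real_tuples n) snd \<Otimes>\<^sub>M ?U) \<and>
    (odd n \<longrightarrow> K = (\<lambda>p. LEAST k. fst (fst p) k \<notin> snd (fst p) ` {..<n}))"
    for n and D :: "((nat \<Rightarrow> real) \<times> (nat \<Rightarrow> real)) measure"
      and K :: "((nat \<Rightarrow> real) \<times> (nat \<Rightarrow> real)) \<times> real \<Rightarrow> nat"
  define law where "law n h = distr \<Omega> (S \<Otimes>\<^sub>M real_tuples n) (\<lambda>\<omega>. (fst \<omega>, h \<omega>))"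
    for n and h :: "(nat \<Rightarrow> real) \<times> (nat \<Rightarrow> real) \<Rightarrow> nat \<Rightarrow> real"
  \<comment> \<open>The selection rule depends on the law of the tuple built so far, so it cannot be
    fixed in advance. The \<open>SOME\<close> is taken unconditionally inside the recursion; that a
    good rule exists is known only after the invariants of \<open>H n\<close> have been
    established.\<close>
  define sel where "sel n h = (SOME K. good n (law n h) K)" for n h
  \<comment> \<open>The constant function \<open>undefined\<close> is the only point of the space of
    empty tuples.\<close>
  define H where "H = rec_nat (\<lambda>\<omega> l. undefined)
      (\<lambda>n h \<omega>. (h \<omega>)(n := fst \<omega> (sel n h ((fst \<omega>, h \<omega>), snd \<omega> n))))"
  define K where "K n = sel n (H n)" for n
  have H0: "H 0 \<omega> = (\<lambda>l. undefined)" for \<omega> by (simp add: H_def)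
  have HS: "H (Suc n) \<omega> = (H n \<omega>)(n := fst \<omega> (K n ((fst \<omega>, H n \<omega>), snd \<omega> n)))" for n \<omega>
    by (simp add: H_def K_def)
  have dep: "H n (x, comb_seq n \<tau> \<tau>') = H n (x, \<tau>)" for n x \<tau> \<tau>'
  proof -
    have "(\<forall>l<n. \<sigma> l = \<sigma>' l) \<longrightarrow> H n (x, \<sigma>) = H n (x, \<sigma>')" for \<sigma> \<sigma>'
      by (induction n) (simp_all add: H0 HS)
    then show ?thesis by (simp add: comb_seq_less)
  qed
  have fst [measurable]: "fst \<in> measurable \<Omega> S" unfolding \<Omega>_def by measurable
  have fst' [measurable]: "fst \<in> measurable \<Omega> real_seqs"
    using fst measurable_cong_sets[OF refl S(2)] by blast
  have fst_law: "distr \<Omega> S fst = S" unfolding \<Omega>_def by (rule T.distr_pair_fst) 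
  have K: "good n (law n (H n)) (K n)" if [measurable]: "H n \<in> measurable \<Omega> (real_tuples n)"
    and ae: "AE \<omega> in \<Omega>. H n \<omega> ` {..<n} \<subseteq> range (fst \<omega>)" for n
  proof -
    let ?D = "law n (H n)"
    have f [measurable]: "(\<lambda>\<omega>. (fst \<omega>, H n \<omega>)) \<in> measurable \<Omega> (S \<Otimes>\<^sub>M real_tuples n)" by measurable
    have D1: "prob_space ?D" unfolding law_def by (rule \<Omega>.prob_space_distr) measurable
    have D2: "sets ?D = sets (S \<Otimes>\<^sub>M real_tuples n)" by (simp add: law_def)
    have D3: "distr ?D S fst = S"
      unfolding law_def by (subst distr_distr) (auto simp: comp_def fst_law)
    have "AE p in ?D. \<forall>l\<in>{..<n}. \<exists>k. snd p l = fst p k"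
      unfolding law_def
    proof (subst AE_distr_iff[OF f])
      have a: "(\<lambda>p. snd p l) \<in> borel_measurable (S \<Otimes>\<^sub>M real_tuples n)" if "l \<in> {..<n}" for l
        using measurable_compose[OF measurable_snd measurable_component_singleton[OF that, of "\<lambda>_. borel"]] .
      have b: "(\<lambda>p. fst p k) \<in> borel_measurable (S \<Otimes>\<^sub>M real_tuples n)" for k
      proof -
        have "(\<lambda>x. x k) \<in> borel_measurable S"
          using measurable_component_singleton[of k UNIV "\<lambda>_. borel"] by (simp add: measurable_cong_sets[OF S(2) refl])
        then show ?thesis by (rule measurable_compose[OF measurable_fst])
      qed
      have "Measurable.pred (S \<Otimes>\<^sub>M real_tuples n) (\<lambda>p. snd p l = fst p k)" if "l \<in> {..<n}" for l k
        using a[OF that] b[of k] by measurable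
      then have "Measurable.pred (S \<Otimes>\<^sub>M real_tuples n) (\<lambda>p. \<forall>l\<in>{..<n}. \<exists>k. snd p l = fst p k)"
        by (intro pred_intros_finite pred_intros_countable) auto
      then show "{p \<in> space (S \<Otimes>\<^sub>M real_tuples n). \<forall>l\<in>{..<n}. \<exists>k. snd p l = fst p k} \<in> sets (S \<Otimes>\<^sub>M real_tuples n)"
        by (simp add: pred_def)
      show "AE \<omega> in \<Omega>. \<forall>l\<in>{..<n}. \<exists>k. snd (fst \<omega>, H n \<omega>) l = fst (fst \<omega>, H n \<omega>) k"
        using ae by eventually_elim auto
    qed
    then have D4: "AE p in ?D. snd p ` {..<n} \<subseteq> range (fst p)" by eventually_elim auto
    have "\<exists>K. good n ?D K"
      unfolding good_def by (rule next_index[OF S D1 D2 D3 D4])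
    then show ?thesis unfolding K_def sel_def by (rule someI_ex)
  qed
  \<comment> \<open>On \<open>\<Omega>\<close> the data of step \<open>n\<close> have exactly the
    product law for which the rule \<open>K n\<close> was chosen.\<close>
  have joint: "distr \<Omega> (law n (H n) \<Otimes>\<^sub>M ?U) (\<lambda>\<omega>. ((fst \<omega>, H n \<omega>), snd \<omega> n)) = law n (H n) \<Otimes>\<^sub>M ?U"
    if "H n \<in> measurable \<Omega> (real_tuples n)" for n
  proof -
    have "(\<lambda>\<omega>. (fst \<omega>, H n \<omega>)) \<in> measurable (S \<Otimes>\<^sub>M ?T) (S \<Otimes>\<^sub>M real_tuples n)"
      using measurable_Pair[OF fst that] unfolding \<Omega>_def .
    from fresh_coordinate_independent[OF S(1) prob_space_unit_uniform this, of n]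
    have "distr \<Omega> ((S \<Otimes>\<^sub>M real_tuples n) \<Otimes>\<^sub>M ?U) (\<lambda>\<omega>. ((fst \<omega>, H n \<omega>), snd \<omega> n)) = law n (H n) \<Otimes>\<^sub>M ?U"
      by (simp add: law_def \<Omega>_def dep)
    moreover have "sets (law n (H n) \<Otimes>\<^sub>M ?U) = sets ((S \<Otimes>\<^sub>M real_tuples n) \<Otimes>\<^sub>M ?U)"
      by (intro sets_pair_measure_cong) (simp_all add: law_def)
    ultimately show ?thesis by (simp cong: distr_cong)
  qed
  have jm: "(\<lambda>\<omega>. ((fst \<omega>, H n \<omega>), snd \<omega> n)) \<in> measurable \<Omega> (law n (H n) \<Otimes>\<^sub>M ?U)"
    if [measurable]: "H n \<in> measurable \<Omega> (real_tuples n)" for n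
  proof -
    have "(\<lambda>\<omega>. snd \<omega> n) \<in> measurable \<Omega> ?U" unfolding \<Omega>_def by measurable
    moreover have "(\<lambda>\<omega>. (fst \<omega>, H n \<omega>)) \<in> measurable \<Omega> (law n (H n))" unfolding law_def by simp
    ultimately show ?thesis by measurable
  qed
  \<comment> \<open>Proved simultaneously, since both parts for \<open>H n\<close> are required to
    obtain the measurable rule \<open>K n\<close> that defines \<open>H (Suc n)\<close>.\<close>
  have inv: "H n \<in> measurable \<Omega> (real_tuples n) \<and> (AE \<omega> in \<Omega>. H n \<omega> ` {..<n} \<subseteq> range (fst \<omega>))" for n
  proof (induction n)
    case 0
    have "H 0 = (\<lambda>_ _. undefined)" by (simp add: fun_eq_iff H0)
    then show ?case by (auto simp: space_PiM intro!: measurable_PiM_single')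
  next
    case (Suc n)
    then have Hn: "H n \<in> measurable \<Omega> (real_tuples n)" by simp
    have "K n \<in> measurable (law n (H n) \<Otimes>\<^sub>M ?U) (count_space UNIV)"
      using K[of n] Suc unfolding good_def by blast
    from measurable_compose[OF jm[OF Hn] this]
    have "(\<lambda>\<omega>. fst \<omega> (K n ((fst \<omega>, H n \<omega>), snd \<omega> n))) \<in> borel_measurable \<Omega>"
      by (rule measurable_evaluate_at_index[OF fst'])
    then have "H (Suc n) \<in> measurable \<Omega> (real_tuples (Suc n))"
      unfolding HS using Hn by (intro measurable_fun_upd[where J = "{..<n}"]) auto
    moreover have "AE \<omega> in \<Omega>. H (Suc n) \<omega> ` {..<Suc n} \<subseteq> range (fst \<omega>)"
      using Suc[THEN conjunct2] by eventually_elim (auto simp: HS lessThan_Suc)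
    ultimately show ?case by blast
  qed
  have Hn [measurable]: "H n \<in> measurable \<Omega> (real_tuples n)" for n using inv by blast
  have good: "good n (law n (H n)) (K n)" for n using K inv by blast
  have m1: "(\<lambda>p. snd (fst p)) \<in> measurable (law n (H n) \<Otimes>\<^sub>M ?U) (real_tuples n)" for n
    unfolding law_def by measurable
  show ?thesis
  proof (rule that[of H])
    fix n
    show "H n \<in> measurable \<Omega> (real_tuples n)" by measurable
    show "H (Suc n) \<omega> l = H n \<omega> l" if "l < n" for l \<omega> using that by (simp add: HS)
    have "AE p in law n (H n) \<Otimes>\<^sub>M ?U. fst (fst p) (K n p) \<notin> snd (fst p) ` {..<n}"
      using good[of n] unfolding good_def by blast
    from AE_from_marginal[OF joint[OF Hn] jm[OF Hn] this]
    show "AE \<omega> in \<Omega>. H (Suc n) \<omega> n \<in> range (fst \<omega>) - H n \<omega> ` {..<n}"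
      by eventually_elim (simp add: HS)
    show "H (Suc n) \<omega> n = fst \<omega> (LEAST k. fst \<omega> k \<notin> H n \<omega> ` {..<n})" if "odd n" for \<omega>
      using good[of n] that unfolding good_def HS by simp
    show "distr \<Omega> (real_tuples n \<Otimes>\<^sub>M ?U) (\<lambda>\<omega>. (H n \<omega>, H (Suc n) \<omega> n)) =
       distr \<Omega> (real_tuples n) (H n) \<Otimes>\<^sub>M ?U" if "even n"
    proof -
      have Km: "K n \<in> measurable (law n (H n) \<Otimes>\<^sub>M ?U) (count_space UNIV)"
        and eq: "distr (law n (H n) \<Otimes>\<^sub>M ?U) (real_tuples n \<Otimes>\<^sub>M ?U) (\<lambda>p. (snd (fst p), fst (fst p) (K n p))) =
         distr (law n (H n)) (real_tuples n) snd \<Otimes>\<^sub>M ?U"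
        using good[of n] that unfolding good_def by blast+
      have "(\<lambda>p. fst (fst p)) \<in> measurable (law n (H n) \<Otimes>\<^sub>M ?U) S" unfolding law_def by measurable
      then have "(\<lambda>p. fst (fst p)) \<in> measurable (law n (H n) \<Otimes>\<^sub>M ?U) real_seqs"
        using measurable_cong_sets[OF refl S(2)] by blast
      from measurable_evaluate_at_index[OF this Km]
      have m2: "(\<lambda>p. (snd (fst p), fst (fst p) (K n p))) \<in> measurable (law n (H n) \<Otimes>\<^sub>M ?U) (real_tuples n \<Otimes>\<^sub>M ?U)"
        using measurable_cong_sets[OF refl, of borel unit_uniform] by (intro measurable_Pair m1) auto
      have "distr \<Omega> (real_tuples n \<Otimes>\<^sub>M ?U) (\<lambda>\<omega>. (H n \<omega>, H (Suc n) \<omega> n)) =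
          distr (distr \<Omega> (law n (H n) \<Otimes>\<^sub>M ?U) (\<lambda>\<omega>. ((fst \<omega>, H n \<omega>), snd \<omega> n)))
            (real_tuples n \<Otimes>\<^sub>M ?U) (\<lambda>p. (snd (fst p), fst (fst p) (K n p)))"
        unfolding distr_distr[OF m2 jm[OF Hn]] by (simp only: comp_def HS fst_conv snd_conv fun_upd_same)
      also have "\<dots> = distr (law n (H n)) (real_tuples n) snd \<Otimes>\<^sub>M ?U"
        unfolding joint[OF Hn] by (rule eq)
      also have "distr (law n (H n)) (real_tuples n) snd = distr \<Omega> (real_tuples n) (H n)"
        unfolding law_def distr_distr[OF measurable_snd measurable_Pair[OF fst Hn]]
        by (simp only: comp_def snd_conv)
      finally show ?thesis .
    qed
  qed
qed

section \<open>Absolute continuity and divergence\<close>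

abbreviation lebesgue_tuples :: "nat \<Rightarrow> (nat \<Rightarrow> real) measure" where
  "lebesgue_tuples n \<equiv> PiM {..<n} (\<lambda>_. lborel)"

lemma sets_lebesgue_tuples: "sets (lebesgue_tuples n) = sets (real_tuples n)"
  by (intro sets_PiM_cong) auto

lemma measurable_snoc:
  "(\<lambda>p. (fst p)(n := snd p)) \<in> measurable (real_tuples n \<Otimes>\<^sub>M borel) (real_tuples (Suc n))"
  by (rule measurable_fun_upd[where J = "{..<n}"]) auto

lemma nn_integral_lebesgue_tuples_Suc:
  assumes "f \<in> borel_measurable (real_tuples (Suc n))"
  shows "(\<integral>\<^sup>+z. f z \<partial>lebesgue_tuples (Suc n)) = (\<integral>\<^sup>+v. \<integral>\<^sup>+s. f (v(n := s)) \<partial>lborel \<partial>lebesgue_tuples n)"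
proof -
  interpret product_sigma_finite "\<lambda>_::nat. lborel :: real measure" ..
  have "f \<in> borel_measurable (PiM (insert n {..<n}) (\<lambda>_. lborel))"
    using assms measurable_cong_sets[OF sets_lebesgue_tuples refl, of "Suc n"] by (simp add: lessThan_Suc)
  from product_nn_integral_insert[OF _ _ this] show ?thesis by (simp add: lessThan_Suc)
qed

lemma emeasure_unit_uniform_le:
  assumes "A \<in> sets borel"
  shows "emeasure unit_uniform A \<le> emeasure lborel A"
proof -
  have "emeasure unit_uniform A = emeasure lborel ({0<..<1} \<inter> A)"
    using assms by (subst emeasure_uniform_measure) (auto simp: divide_ennreal_def)
  also have "\<dots> \<le> emeasure lborel A" using assms by (intro emeasure_mono) auto
  finally show ?thesis .
qed

text \<open>Induction on the length by Fubini: almost all sections of a null set in the last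
  coordinate are null, and the exceptional initial tuples form a null set, avoided by induction.
  Over the remaining initial tuples saturation admits no further point in the section; injectivity
  says precisely that the last entry is such a further point.\<close>

lemma distinct_tuples_avoid_null:
  assumes "saturated S" "N \<in> null_sets (lebesgue_tuples n)"
  shows "AE x in S. \<forall>v\<in>{..<n} \<rightarrow>\<^sub>E range x. inj_on v {..<n} \<longrightarrow> v \<notin> N"
  using assms(2)
proof (induction n arbitrary: N)
  case 0
  have "N \<in> sets (lebesgue_tuples 0)" "emeasure (lebesgue_tuples 0) N = 0" using 0 by auto
  have "(\<lambda>_. undefined) \<notin> N"
  proof
    assume *: "(\<lambda>_. undefined) \<in> N"
    have "N \<subseteq> space (lebesgue_tuples 0)" by (rule sets.sets_into_space) fact
    then have "N = {\<lambda>_. undefined}" using * by (auto simp: space_PiM)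
    then show False using \<open>emeasure (lebesgue_tuples 0) N = 0\<close> by (simp add: emeasure_PiM_empty)
  qed
  then show ?case by auto
next
  case (Suc n)
  \<comment> \<open>\<open>N\<close> with its last coordinate split off, in the form required by
    saturation.\<close>
  define C where "C = (\<lambda>p. (fst p)(n := snd p)) -` N \<inter> space (real_tuples n \<Otimes>\<^sub>M borel)"
  have N: "N \<in> sets (real_tuples (Suc n))" "emeasure (lebesgue_tuples (Suc n)) N = 0"
    using Suc.prems by (auto simp: null_sets_def sets_lebesgue_tuples)
  have C: "C \<in> sets (real_tuples n \<Otimes>\<^sub>M borel)"
    unfolding C_def by (rule measurable_sets[OF measurable_snoc N(1)])
  then have C': "C \<in> sets (lebesgue_tuples n \<Otimes>\<^sub>M lborel)"
    by (simp add: sets_pair_measure_cong[OF sets_lebesgue_tuples sets_lborel])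
  have Cm: "(\<lambda>v. emeasure lborel (Pair v -` C)) \<in> borel_measurable (lebesgue_tuples n)"
    by (rule lborel.measurable_emeasure_Pair[OF C'])
  have "emeasure (lebesgue_tuples (Suc n)) N = (\<integral>\<^sup>+z. indicator N z \<partial>lebesgue_tuples (Suc n))"
    using N(1) by (simp add: sets_lebesgue_tuples)
  also have "\<dots> = (\<integral>\<^sup>+v. \<integral>\<^sup>+s. indicator N (v(n := s)) \<partial>lborel \<partial>lebesgue_tuples n)"
    by (rule nn_integral_lebesgue_tuples_Suc) (use N(1) in auto)
  also have "\<dots> = (\<integral>\<^sup>+v. emeasure lborel (Pair v -` C) \<partial>lebesgue_tuples n)"
  proof (rule nn_integral_cong)
    fix v :: "nat \<Rightarrow> real" assume v: "v \<in> space (lebesgue_tuples n)"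
    have "(\<integral>\<^sup>+s. indicator N (v(n := s)) \<partial>lborel) = (\<integral>\<^sup>+s. indicator (Pair v -` C) s \<partial>lborel)"
      using v by (intro nn_integral_cong) (auto simp: C_def indicator_def space_pair_measure space_PiM)
    then show "(\<integral>\<^sup>+s. indicator N (v(n := s)) \<partial>lborel) = emeasure lborel (Pair v -` C)"
      using sets_Pair1[OF C] by simp
  qed
  finally have "(\<integral>\<^sup>+v. emeasure lborel (Pair v -` C) \<partial>lebesgue_tuples n) = 0" using N(2) by simp
  then have "AE v in lebesgue_tuples n. emeasure lborel (Pair v -` C) = 0"
    using Cm by (subst (asm) nn_integral_0_iff_AE) auto
  then obtain N' where N': "{v \<in> space (lebesgue_tuples n). emeasure lborel (Pair v -` C) \<noteq> 0} \<subseteq> N'"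
    "emeasure (lebesgue_tuples n) N' = 0" "N' \<in> sets (lebesgue_tuples n)" by (rule AE_E)
  have "AE x in S. \<forall>v\<in>{..<n} \<rightarrow>\<^sub>E range x. emeasure unit_uniform (Pair v -` C) \<noteq> 0 \<longleftrightarrow>
      (\<exists>k. x k \<notin> v ` {..<n} \<and> (v, x k) \<in> C)"
    using assms(1) C unfolding saturated_def by blast
  moreover have "AE x in S. \<forall>v\<in>{..<n} \<rightarrow>\<^sub>E range x. inj_on v {..<n} \<longrightarrow> v \<notin> N'"
    by (rule Suc.IH) (use N' in auto)
  ultimately show ?case
  proof eventually_elim
    case (elim x)
    show ?case
    proof (intro ballI impI notI)
      fix v assume v: "v \<in> {..<Suc n} \<rightarrow>\<^sub>E range x" "inj_on v {..<Suc n}" "v \<in> N"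
      define u where "u = restrict v {..<n}"
      have u: "u \<in> {..<n} \<rightarrow>\<^sub>E range x" using v(1) by (auto simp: u_def PiE_iff)
      have "inj_on u {..<n}" using v(2) by (auto simp: u_def inj_on_def)
      then have "u \<notin> N'" using elim(2) u by blast
      moreover have us: "u \<in> space (lebesgue_tuples n)" by (auto simp: u_def space_PiM)
      ultimately have "emeasure lborel (Pair u -` C) = 0" using N'(1) by auto
      then have "emeasure unit_uniform (Pair u -` C) = 0"
        using emeasure_unit_uniform_le[OF sets_Pair1[OF C, of u]] by simp
      with elim(1) u have no: "\<not> (\<exists>k. x k \<notin> u ` {..<n} \<and> (u, x k) \<in> C)" by blast
      obtain k where k: "v n = x k" using v(1) by (auto simp: PiE_iff)
      have vu: "v = u(n := x k)"
        using v(1) k by (auto simp: u_def fun_eq_iff PiE_iff extensional_def less_Suc_eq)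
      have "(u, x k) \<in> C" using v(3) us by (auto simp: C_def vu[symmetric] space_pair_measure space_PiM)
      moreover have "x k \<notin> u ` {..<n}"
      proof
        assume "x k \<in> u ` {..<n}"
        then obtain l where l: "l < n" "v l = v n" by (auto simp: u_def k)
        then have "l = n" by (intro inj_onD[OF v(2)]) auto
        with l show False by simp
      qed
      ultimately show False using no by blast
    qed
  qed
qed

text \<open>Saturation for the empty tuple, whose section is taken to be the null complement of the
  unit interval.\<close>

lemma saturated_range_in_unit_interval:
  assumes "saturated S"
  shows "AE x in S. \<forall>k. x k \<in> {0<..<1}"
proof -
  let ?C = "space (real_tuples 0) \<times> - {0<..<1::real}"
  have "?C \<in> sets (real_tuples 0 \<Otimes>\<^sub>M borel)" by (intro pair_measureI) (auto simp: borel_comp)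
  then have "AE x in S. \<forall>v\<in>{..<0} \<rightarrow>\<^sub>E range x. emeasure unit_uniform (Pair v -` ?C) \<noteq> 0 \<longleftrightarrow>
      (\<exists>k. x k \<notin> v ` {..<0} \<and> (v, x k) \<in> ?C)"
    using assms unfolding saturated_def by blast
  then show ?thesis
  proof eventually_elim
    case (elim x)
    have "Pair (\<lambda>_. undefined) -` ?C = - {0<..<1}" by (auto simp: space_PiM)
    moreover have "emeasure unit_uniform (- {0<..<1}) = 0"
      by (subst emeasure_uniform_measure) (auto simp: borel_comp)
    ultimately show ?case using elim by (auto simp: space_PiM)
  qed
qed

text \<open>Radon-Nikodym in a real-valued version. Positivity along \<open>h\<close> is recorded
  because the density later occurs as a denominator, and \<open>0 / 0 = 0\<close> would destroy the
  divergence.\<close>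

lemma density_of_distinct_tuples:
  assumes "prob_space \<Omega>" and h: "h \<in> measurable \<Omega> (real_tuples n)"
    and null: "\<And>N. N \<in> null_sets (lebesgue_tuples n) \<Longrightarrow> AE \<omega> in \<Omega>. h \<omega> \<notin> N"
  shows "\<exists>g :: (nat \<Rightarrow> real) \<Rightarrow> real. g \<in> borel_measurable (lebesgue_tuples n) \<and> (\<forall>z. 0 \<le> g z) \<and>
    distr \<Omega> (lebesgue_tuples n) h = density (lebesgue_tuples n) (\<lambda>z. ennreal (g z)) \<and>
    (AE \<omega> in \<Omega>. 0 < g (h \<omega>))"
proof -
  interpret prob_space \<Omega> by fact
  interpret product_sigma_finite "\<lambda>_::nat. lborel :: real measure" ..
  interpret L: sigma_finite_measure "lebesgue_tuples n" by (rule sigma_finite) simp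
  have h' [measurable]: "h \<in> measurable \<Omega> (lebesgue_tuples n)"
    using h measurable_cong_sets[OF refl sets_lebesgue_tuples] by blast
  let ?N = "distr \<Omega> (lebesgue_tuples n) h"
  interpret N: prob_space ?N by (rule prob_space_distr) fact
  have ac: "absolutely_continuous (lebesgue_tuples n) ?N"
    unfolding absolutely_continuous_def
  proof
    fix A assume A: "A \<in> null_sets (lebesgue_tuples n)"
    then have [measurable]: "A \<in> sets (lebesgue_tuples n)" by auto
    have "AE \<omega> in \<Omega>. \<omega> \<notin> h -` A \<inter> space \<Omega>" using null[OF A] by eventually_elim auto
    then have "emeasure \<Omega> (h -` A \<inter> space \<Omega>) = 0"
      by (subst (asm) AE_iff_measurable[OF _ refl]) (auto simp: Int_def conj_commute cong: conj_cong)
    then show "A \<in> null_sets ?N" by (auto simp: emeasure_distr intro!: null_setsI)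
  qed
  obtain g where g: "g \<in> borel_measurable (lebesgue_tuples n)"
    "AE z in lebesgue_tuples n. RN_deriv (lebesgue_tuples n) ?N z = ennreal (g z)"
    "AE z in ?N. 0 < g z" "\<And>z. 0 \<le> g z"
    using L.real_RN_deriv[OF N.finite_measure_axioms ac sets_distr] by blast
  have "?N = density (lebesgue_tuples n) (RN_deriv (lebesgue_tuples n) ?N)"
    by (rule L.density_RN_deriv[OF ac sets_distr, symmetric])
  also have "\<dots> = density (lebesgue_tuples n) (\<lambda>z. ennreal (g z))"
    using g(1,2) by (intro density_cong) auto
  finally have "?N = density (lebesgue_tuples n) (\<lambda>z. ennreal (g z))" .
  moreover have "AE \<omega> in \<Omega>. 0 < g (h \<omega>)" using AE_distrD[OF h' g(3)] .
  ultimately show ?thesis using g(1,4) by blast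
qed

text \<open>Appending an independent uniform coordinate multiplies the density by an indicator. The
  point is this explicit version: its quotient by \<open>g\<close> is 1 wherever \<open>g\<close> is
  positive and the new coordinate is in the unit interval.\<close>

lemma density_snoc_uniform:
  assumes "prob_space \<Omega>" and h: "h \<in> measurable \<Omega> (real_tuples n)"
    and h': "h' \<in> measurable \<Omega> (real_tuples (Suc n))"
    and ext: "\<And>\<omega>. \<omega> \<in> space \<Omega> \<Longrightarrow> h' \<omega> = (h \<omega>)(n := h' \<omega> n)"
    and law: "distr \<Omega> (real_tuples n \<Otimes>\<^sub>M unit_uniform) (\<lambda>\<omega>. (h \<omega>, h' \<omega> n)) =
      distr \<Omega> (real_tuples n) h \<Otimes>\<^sub>M unit_uniform"
    and g [measurable]: "g \<in> borel_measurable (lebesgue_tuples n)" and g0: "\<And>z. 0 \<le> g z"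
    and dens: "distr \<Omega> (lebesgue_tuples n) h = density (lebesgue_tuples n) (\<lambda>z. ennreal (g z))"
  shows "(\<lambda>z. g (restrict z {..<n}) * indicator {0<..<1} (z n)) \<in> borel_measurable (lebesgue_tuples (Suc n))"
    and "distr \<Omega> (lebesgue_tuples (Suc n)) h' =
      density (lebesgue_tuples (Suc n)) (\<lambda>z. ennreal (g (restrict z {..<n}) * indicator {0<..<1} (z n)))"
proof -
  interpret prob_space \<Omega> by fact
  interpret U: prob_space unit_uniform by (rule prob_space_unit_uniform)
  have [measurable_cong]: "sets (lebesgue_tuples k) = sets (real_tuples k)" for k by (rule sets_lebesgue_tuples)
  have [measurable]: "(\<lambda>z. z n) \<in> borel_measurable (real_tuples (Suc n))"
    by (rule measurable_component_singleton) simp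
  have [measurable]: "(\<lambda>z. restrict z {..<n}) \<in> measurable (real_tuples (Suc n)) (real_tuples n)"
    by (rule measurable_restrict_subset) auto
  show m: "(\<lambda>z. g (restrict z {..<n}) * indicator {0<..<1} (z n)) \<in> borel_measurable (lebesgue_tuples (Suc n))"
    by measurable
  note [measurable] = measurable_snoc h h'
  have hn [measurable]: "(\<lambda>\<omega>. h' \<omega> n) \<in> borel_measurable \<Omega>"
    by (rule measurable_compose[OF h']) measurable
  show "distr \<Omega> (lebesgue_tuples (Suc n)) h' =
      density (lebesgue_tuples (Suc n)) (\<lambda>z. ennreal (g (restrict z {..<n}) * indicator {0<..<1} (z n)))"
  proof (rule measure_eqI)
    fix A assume "A \<in> sets (distr \<Omega> (lebesgue_tuples (Suc n)) h')"
    then have A [measurable]: "A \<in> sets (real_tuples (Suc n))" by (simp add: sets_lebesgue_tuples)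
    define F :: "(nat \<Rightarrow> real) \<times> real \<Rightarrow> ennreal" where "F = (\<lambda>p. indicator A ((fst p)(n := snd p)))"
    have F [measurable]: "F \<in> borel_measurable (real_tuples n \<Otimes>\<^sub>M borel)" unfolding F_def by measurable
    have "emeasure (distr \<Omega> (lebesgue_tuples (Suc n)) h') A = (\<integral>\<^sup>+\<omega>. indicator A (h' \<omega>) \<partial>\<Omega>)"
      by (subst nn_integral_indicator[symmetric], simp add: sets_lebesgue_tuples, subst nn_integral_distr) auto
    also have "\<dots> = (\<integral>\<^sup>+\<omega>. F (h \<omega>, h' \<omega> n) \<partial>\<Omega>)"
      by (intro nn_integral_cong) (simp add: F_def ext[symmetric])
    also have "\<dots> = (\<integral>\<^sup>+p. F p \<partial>(distr \<Omega> (real_tuples n \<Otimes>\<^sub>M unit_uniform) (\<lambda>\<omega>. (h \<omega>, h' \<omega> n))))"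
      by (rule nn_integral_distr[symmetric]) measurable
    also have "\<dots> = (\<integral>\<^sup>+p. F p \<partial>(distr \<Omega> (real_tuples n) h \<Otimes>\<^sub>M unit_uniform))"
      unfolding law ..
    also have "\<dots> = (\<integral>\<^sup>+v. \<integral>\<^sup>+s. F (v, s) \<partial>unit_uniform \<partial>(distr \<Omega> (real_tuples n) h))"
      by (rule U.nn_integral_fst[symmetric]) measurable
    also have "distr \<Omega> (real_tuples n) h = distr \<Omega> (lebesgue_tuples n) h"
      by (rule distr_cong) (auto simp: sets_lebesgue_tuples)
    also have "\<dots> = density (lebesgue_tuples n) (\<lambda>z. ennreal (g z))" by (rule dens)
    also have "(\<integral>\<^sup>+v. \<integral>\<^sup>+s. F (v, s) \<partial>unit_uniform \<partial>density (lebesgue_tuples n) (\<lambda>z. ennreal (g z))) =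
        (\<integral>\<^sup>+v. ennreal (g v) * (\<integral>\<^sup>+s. F (v, s) \<partial>unit_uniform) \<partial>lebesgue_tuples n)"
      by (rule nn_integral_density) measurable
    also have "\<dots> = (\<integral>\<^sup>+v. \<integral>\<^sup>+s. ennreal (g (restrict (v(n := s)) {..<n}) * indicator {0<..<1} ((v(n := s)) n))
        * indicator A (v(n := s)) \<partial>lborel \<partial>lebesgue_tuples n)"
    proof (rule nn_integral_cong)
      fix v :: "nat \<Rightarrow> real" assume v: "v \<in> space (lebesgue_tuples n)"
      have res: "restrict (v(n := s)) {..<n} = v" for s
        using v by (auto simp: space_PiM PiE_iff fun_eq_iff extensional_def)
      have [measurable]: "(\<lambda>s. F (v, s)) \<in> borel_measurable borel"
        by (rule measurable_compose[OF measurable_Pair1' F]) (use v in \<open>simp add: space_PiM\<close>)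
      have "(\<integral>\<^sup>+s. F (v, s) \<partial>unit_uniform) = (\<integral>\<^sup>+s. F (v, s) * indicator {0<..<1} s \<partial>lborel)"
        by (subst nn_integral_uniform_measure) (auto simp: divide_ennreal_def)
      then have "ennreal (g v) * (\<integral>\<^sup>+s. F (v, s) \<partial>unit_uniform) =
          (\<integral>\<^sup>+s. ennreal (g v) * (F (v, s) * indicator {0<..<1} s) \<partial>lborel)"
        by (simp add: nn_integral_cmult)
      also have "\<dots> = (\<integral>\<^sup>+s. ennreal (g (restrict (v(n := s)) {..<n}) * indicator {0<..<1} ((v(n := s)) n))
        * indicator A (v(n := s)) \<partial>lborel)"
        by (intro nn_integral_cong) (auto simp: res F_def indicator_def)
      finally show "ennreal (g v) * (\<integral>\<^sup>+s. F (v, s) \<partial>unit_uniform) =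
        (\<integral>\<^sup>+s. ennreal (g (restrict (v(n := s)) {..<n}) * indicator {0<..<1} ((v(n := s)) n))
          * indicator A (v(n := s)) \<partial>lborel)" .
    qed
    also have "\<dots> = (\<integral>\<^sup>+z. ennreal (g (restrict z {..<n}) * indicator {0<..<1} (z n)) * indicator A z \<partial>lebesgue_tuples (Suc n))"
      by (rule nn_integral_lebesgue_tuples_Suc[symmetric]) measurable
    also have "\<dots> = emeasure (density (lebesgue_tuples (Suc n))
        (\<lambda>z. ennreal (g (restrict z {..<n}) * indicator {0<..<1} (z n)))) A"
      by (rule emeasure_density[symmetric]) (use m in \<open>auto simp: sets_lebesgue_tuples\<close>)
    finally show "emeasure (distr \<Omega> (lebesgue_tuples (Suc n)) h') A = emeasure (density (lebesgue_tuples (Suc n))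
        (\<lambda>z. ennreal (g (restrict z {..<n}) * indicator {0<..<1} (z n)))) A" .
  qed simp
qed

section \<open>From the enumeration to the uniform distribution\<close>

lemma uniform_distribution_if_saturated:
  assumes X: "random_countable_subset M X" and sat: "saturated (seq_law M X)"
  shows "uniform_distribution M X"
proof -
  let ?T = "PiM UNIV (\<lambda>_::nat. unit_uniform)"
  interpret M: prob_space M using X by (simp add: random_countable_subset_def)
  have [measurable]: "X k \<in> borel_measurable M" for k using X by (simp add: random_countable_subset_def)
  define S where "S = seq_law M X"
  have S: "prob_space S" "sets S = sets real_seqs" "saturated S"
    unfolding S_def using sat by (auto simp: seq_law_def intro!: M.prob_space_distr measurable_PiM_single')
  interpret S: prob_space S by fact
  interpret T: prob_space ?T by (rule prob_space_PiM) (rule prob_space_unit_uniform)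
  interpret ST: pair_prob_space S ?T ..
  define \<Omega> where "\<Omega> = S \<Otimes>\<^sub>M ?T"
  interpret \<Omega>: prob_space \<Omega> unfolding \<Omega>_def by (rule ST.P.prob_space_axioms)
  have fst: "fst \<in> measurable \<Omega> S" unfolding \<Omega>_def by measurable
  have fst_law: "distr \<Omega> S fst = S" unfolding \<Omega>_def by (rule T.distr_pair_fst)
  obtain H :: "nat \<Rightarrow> (nat \<Rightarrow> real) \<times> (nat \<Rightarrow> real) \<Rightarrow> nat \<Rightarrow> real"
    where H: "\<And>n. H n \<in> measurable \<Omega> (real_tuples n)"
      "\<And>n l \<omega>. l < n \<Longrightarrow> H (Suc n) \<omega> l = H n \<omega> l"
      "\<And>n. AE \<omega> in \<Omega>. H (Suc n) \<omega> n \<in> range (fst \<omega>) - H n \<omega> ` {..<n}"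
      "\<And>n. even n \<Longrightarrow> distr \<Omega> (real_tuples n \<Otimes>\<^sub>M unit_uniform) (\<lambda>\<omega>. (H n \<omega>, H (Suc n) \<omega> n)) =
         distr \<Omega> (real_tuples n) (H n) \<Otimes>\<^sub>M unit_uniform"
      "\<And>n \<omega>. odd n \<Longrightarrow> H (Suc n) \<omega> n = fst \<omega> (LEAST k. fst \<omega> k \<notin> H n \<omega> ` {..<n})"
    using sequential_enumeration[OF S] unfolding \<Omega>_def by blast
  define y where "y \<omega> i = H (Suc i) \<omega> i" for \<omega> i
  have yH: "H n \<omega> l = y \<omega> l" if "l < n" for n l \<omega>
    using that by (induction n) (auto simp: y_def H(2) less_Suc_eq)
  have Himg: "H n \<omega> ` {..<n} = y \<omega> ` {..<n}" for n \<omega> by (rule image_cong) (auto simp: yH)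
  have restr: "restrict (y \<omega>) {..<n} = H n \<omega>" if "\<omega> \<in> space \<Omega>" for n \<omega>
    using measurable_space[OF H(1)[of n] that] by (auto simp: space_PiM PiE_iff extensional_def fun_eq_iff yH)
  have ym: "y \<in> measurable \<Omega> real_seqs"
  proof (rule measurable_PiM_single')
    fix i :: nat
    show "(\<lambda>\<omega>. y \<omega> i) \<in> borel_measurable \<Omega>"
      unfolding y_def by (rule measurable_compose[OF H(1) measurable_component_singleton]) simp
  qed (auto simp: space_PiM)
  have enum: "AE \<omega> in \<Omega>. \<forall>n. y \<omega> n \<in> range (fst \<omega>) - y \<omega> ` {..<n}"
    by (subst AE_all_countable) (use H(3) in \<open>simp add: y_def[symmetric] Himg\<close>)
  then have yinj: "AE \<omega> in \<Omega>. inj (y \<omega>)"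
  proof eventually_elim
    case (elim \<omega>)
    show ?case
    proof (rule linorder_injI)
      fix i j :: nat assume "i < j"
      then have "y \<omega> i \<in> y \<omega> ` {..<j}" by simp
      moreover have "y \<omega> j \<notin> y \<omega> ` {..<j}" using elim by blast
      ultimately show "y \<omega> i \<noteq> y \<omega> j" by metis
    qed
  qed
  have yrange: "AE \<omega> in \<Omega>. range (fst \<omega>) = range (y \<omega>)"
    using enum
  proof eventually_elim
    case (elim \<omega>)
    \<comment> \<open>The odd step with index \<open>2 * m + 1\<close> lists the first missing
      point. The points with index below \<open>m\<close> being already present, this is point
      \<open>m\<close> unless it has been listed before.\<close>
    have listed: "\<forall>j<m. fst \<omega> j \<in> y \<omega> ` {..<2 * m}" for m
    proof (induction m)
      case (Suc m)
      let ?n = "Suc (2 * m)"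
      have sub: "y \<omega> ` {..<2 * m} \<subseteq> y \<omega> ` {..<?n}" by auto
      have "fst \<omega> m \<in> y \<omega> ` {..<Suc ?n}"
      proof (cases "fst \<omega> m \<in> y \<omega> ` {..<?n}")
        case False
        have "(LEAST k. fst \<omega> k \<notin> y \<omega> ` {..<?n}) = m"
        proof (rule Least_equality)
          fix k assume k: "fst \<omega> k \<notin> y \<omega> ` {..<?n}"
          show "m \<le> k"
          proof (rule ccontr)
            assume "\<not> m \<le> k"
            then have "fst \<omega> k \<in> y \<omega> ` {..<2 * m}" using Suc.IH by simp
            with k sub show False by blast
          qed
        qed fact
        then have "y \<omega> ?n = fst \<omega> m"
          using H(5)[of ?n \<omega>] by (simp add: y_def[symmetric] Himg)
        then show ?thesis by (metis imageI lessI lessThan_iff)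
      qed auto
      moreover have "y \<omega> ` {..<2 * m} \<subseteq> y \<omega> ` {..<2 * Suc m}" by (intro image_mono) auto
      ultimately show ?case using Suc.IH by (auto simp: less_Suc_eq)
    qed simp
    have "fst \<omega> j \<in> range (y \<omega>)" for j using listed[of "Suc j"] by blast
    then show ?case using elim by blast
  qed
  define \<nu> where "\<nu> = distr \<Omega> real_seqs y"
  have s\<nu>: "sets \<nu> = sets real_seqs" by (simp add: \<nu>_def)
  have ym': "y \<in> measurable \<Omega> \<nu>" using ym by (simp add: \<nu>_def)
  have p\<nu>: "prob_space \<nu>" unfolding \<nu>_def by (rule \<Omega>.prob_space_distr[OF ym])
  have m_restr: "(\<lambda>y. restrict y {..<n}) \<in> measurable real_seqs (lebesgue_tuples n)" for n
    by (rule measurable_restrict) simp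

  have "\<exists>g :: (nat \<Rightarrow> real) \<Rightarrow> real. g \<in> borel_measurable (lebesgue_tuples n) \<and> (\<forall>z. 0 \<le> g z) \<and>
    distr \<Omega> (lebesgue_tuples n) (H n) = density (lebesgue_tuples n) (\<lambda>z. ennreal (g z)) \<and>
    (AE \<omega> in \<Omega>. 0 < g (H n \<omega>))" for n
  proof (rule density_of_distinct_tuples[OF \<Omega>.prob_space_axioms H(1)])
    fix N assume "N \<in> null_sets (lebesgue_tuples n)"
    from distinct_tuples_avoid_null[OF S(3) this]
    have "AE \<omega> in \<Omega>. \<forall>v\<in>{..<n} \<rightarrow>\<^sub>E range (fst \<omega>). inj_on v {..<n} \<longrightarrow> v \<notin> N"
      by (rule AE_from_marginal[OF fst_law fst])
    then show "AE \<omega> in \<Omega>. H n \<omega> \<notin> N"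
      using enum yinj AE_space[of \<Omega>]
    proof eventually_elim
      case (elim \<omega>)
      have "H n \<omega> \<in> {..<n} \<rightarrow>\<^sub>E range (fst \<omega>)"
        unfolding restr[OF elim(4), symmetric] using elim(2) by auto
      moreover have "inj_on (H n \<omega>) {..<n}"
        unfolding restr[OF elim(4), symmetric] using elim(3) by (auto simp: inj_on_def)
      ultimately show ?case using elim(1) by blast
    qed
  qed
  then obtain g :: "nat \<Rightarrow> (nat \<Rightarrow> real) \<Rightarrow> real" where g: "\<And>n. g n \<in> borel_measurable (lebesgue_tuples n)"
    "\<And>n z. 0 \<le> g n z"
    "\<And>n. distr \<Omega> (lebesgue_tuples n) (H n) = density (lebesgue_tuples n) (\<lambda>z. ennreal (g n z))"
    "\<And>n. AE \<omega> in \<Omega>. 0 < g n (H n \<omega>)" by metis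
  \<comment> \<open>At even lengths any Radon-Nikodym version will do. At odd lengths the last
    coordinate was a uniform choice, so the product version over the even length before it is
    taken.\<close>
  define f where "f n z = (if even n then g n z
      else g (n - 1) (restrict z {..<n - 1}) * indicator {0<..<1} (z (n - 1)))" for n z
  have f: "f n \<in> borel_measurable (lebesgue_tuples n) \<and>
      distr \<Omega> (lebesgue_tuples n) (H n) = density (lebesgue_tuples n) (\<lambda>z. ennreal (f n z))" for n
  proof (cases "even n")
    case True
    then have "f n = g n" by (simp add: f_def fun_eq_iff)
    then show ?thesis using g by simp
  next
    case False
    then obtain k where k: "n = Suc k" "even k" by (cases n) auto
    have fn: "f n = (\<lambda>z. g k (restrict z {..<k}) * indicator {0<..<1} (z k))"
      using k by (simp add: f_def fun_eq_iff)
    have ext: "H (Suc k) \<omega> = (H k \<omega>)(k := H (Suc k) \<omega> k)" if "\<omega> \<in> space \<Omega>" for \<omega>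
      unfolding restr[OF that, symmetric] by (auto simp: fun_eq_iff less_Suc_eq)
    show ?thesis
      using density_snoc_uniform[OF \<Omega>.prob_space_axioms H(1) H(1) ext H(4)[OF k(2)] g(1,2,3)]
      unfolding fn unfolding k(1) by blast
  qed
  have f_law: "distr \<nu> (lebesgue_tuples n) (\<lambda>y. restrict y {..<n}) = density (lebesgue_tuples n) (\<lambda>z. ennreal (f n z))" for n
  proof -
    have "distr \<nu> (lebesgue_tuples n) (\<lambda>y. restrict y {..<n}) = distr \<Omega> (lebesgue_tuples n) (\<lambda>\<omega>. restrict (y \<omega>) {..<n})"
      unfolding \<nu>_def distr_distr[OF m_restr ym] by (simp add: comp_def)
    also have "\<dots> = distr \<Omega> (lebesgue_tuples n) (H n)" by (rule distr_cong) (auto simp: restr)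
    finally show ?thesis using f by simp
  qed
  have pos: "AE y in \<nu>. \<forall>n. 0 < g n (restrict y {..<n})"
  proof (subst AE_all_countable, intro allI)
    fix n
    have "{y \<in> space real_seqs. 0 < g n (restrict y {..<n})} \<in> sets real_seqs"
      using measurable_compose[OF m_restr g(1)[of n]] by measurable
    moreover have "AE \<omega> in \<Omega>. 0 < g n (restrict (y \<omega>) {..<n})"
      using g(4)[of n] AE_space by eventually_elim (simp add: restr)
    ultimately show "AE y in \<nu>. 0 < g n (restrict y {..<n})"
      unfolding \<nu>_def by (subst AE_distr_iff[OF ym])
  qed
  \<comment> \<open>The coupling is the joint law on \<open>\<Omega>\<close> of the original
    sequence and its enumeration.\<close>
  have coupled: "coupled_sets S range \<nu> range"
    unfolding coupled_sets_def
  proof (intro exI conjI)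
    let ?P = "distr \<Omega> (S \<Otimes>\<^sub>M \<nu>) (\<lambda>\<omega>. (fst \<omega>, y \<omega>))"
    have pm: "(\<lambda>\<omega>. (fst \<omega>, y \<omega>)) \<in> measurable \<Omega> (S \<Otimes>\<^sub>M \<nu>)" by (rule measurable_Pair[OF fst ym'])
    show "prob_space ?P" by (rule \<Omega>.prob_space_distr[OF pm])
    show "sets ?P = sets (S \<Otimes>\<^sub>M \<nu>)" by simp
    show "distr ?P S fst = S"
      unfolding distr_distr[OF measurable_fst pm] by (simp add: comp_def fst_law)
    have "distr \<Omega> \<nu> y = \<nu>" unfolding \<nu>_def by (rule distr_cong) auto
    then show "distr ?P \<nu> snd = \<nu>"
      unfolding distr_distr[OF measurable_snd pm] by (simp add: comp_def)
    have c1: "(\<lambda>p. fst p k) \<in> borel_measurable (S \<Otimes>\<^sub>M \<nu>)" and c2: "(\<lambda>p. snd p k) \<in> borel_measurable (S \<Otimes>\<^sub>M \<nu>)" for k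
      using measurable_component_singleton[of k UNIV "\<lambda>_. borel"]
      by (auto intro!: measurable_compose[OF measurable_fst] measurable_compose[OF measurable_snd]
          simp: measurable_cong_sets[OF S(2) refl] measurable_cong_sets[OF s\<nu> refl])
    have "Measurable.pred (S \<Otimes>\<^sub>M \<nu>) (\<lambda>p. fst p j = snd p k)" for j k
      using c1[of j] c2[of k] by measurable
    then have "Measurable.pred (S \<Otimes>\<^sub>M \<nu>) (\<lambda>p. (\<forall>j. \<exists>k. fst p j = snd p k) \<and> (\<forall>k. \<exists>j. fst p j = snd p k))"
      by (intro pred_intros_logic pred_intros_countable)
    then have ms: "{p \<in> space (S \<Otimes>\<^sub>M \<nu>). (\<forall>j. \<exists>k. fst p j = snd p k) \<and> (\<forall>k. \<exists>j. fst p j = snd p k)} \<in> sets (S \<Otimes>\<^sub>M \<nu>)"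
      by (simp add: pred_def)
    have "AE p in ?P. (\<forall>j. \<exists>k. fst p j = snd p k) \<and> (\<forall>k. \<exists>j. fst p j = snd p k)"
      unfolding AE_distr_iff[OF pm ms]
      using yrange
    proof eventually_elim
      case (elim \<omega>)
      have "\<exists>k. fst \<omega> j = y \<omega> k" for j using elim by (metis rangeE rangeI)
      moreover have "\<exists>j. fst \<omega> j = y \<omega> k" for k using elim by (metis rangeE rangeI)
      ultimately show ?case by simp
    qed
    then show "AE p in ?P. range (fst p) = range (snd p)"
    proof eventually_elim
      case (elim p)
      show ?case
      proof (intro equalityI subsetI)
        fix s assume "s \<in> range (fst p)"
        then obtain j where "s = fst p j" by blast
        moreover obtain k where "fst p j = snd p k" using elim by blast
        ultimately show "s \<in> range (snd p)" by simp
      next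
        fix s assume "s \<in> range (snd p)"
        then obtain k where "s = snd p k" by blast
        moreover obtain j where "fst p j = snd p k" using elim by blast
        ultimately show "s \<in> range (fst p)" by (metis rangeI)
      qed
    qed
  qed
  have in01: "AE y in \<nu>. \<forall>k. y k \<in> {0<..<1}"
  proof -
    have "{y \<in> space real_seqs. \<forall>k. y k \<in> {0<..<1}} \<in> sets real_seqs" by measurable
    moreover have "AE \<omega> in \<Omega>. \<forall>k. y \<omega> k \<in> {0<..<1}"
      using AE_from_marginal[OF fst_law fst saturated_range_in_unit_interval[OF S(3)]] enum
    proof eventually_elim
      case (elim \<omega>)
      show ?case
      proof
        fix k
        obtain j where "y \<omega> k = fst \<omega> j" using elim(2) by blast
        then show "y \<omega> k \<in> {0<..<1}" using elim(1) by metis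
      qed
    qed
    ultimately show ?thesis unfolding \<nu>_def by (subst AE_distr_iff[OF ym])
  qed
  have diverges: "\<not> summable (\<lambda>m. f (m + 2) (restrict (y(Suc m := x)) {..<m + 2}) / f (m + 1) (restrict y {..<m + 1}))"
    if y: "\<forall>n. 0 < g n (restrict y {..<n})" and x: "x \<in> {0<..<1}" for x :: real and y :: "nat \<Rightarrow> real"
  proof
    let ?q = "\<lambda>m. f (m + 2) (restrict (y(Suc m := x)) {..<m + 2}) / f (m + 1) (restrict y {..<m + 1})"
    assume "summable ?q"
    then have "?q \<longlonglongrightarrow> 0" by (rule summable_LIMSEQ_zero)
    then have "eventually (\<lambda>m. ?q m < 1) sequentially" by (rule order_tendstoD) simp
    then obtain N where N: "\<And>m. m \<ge> N \<Longrightarrow> ?q m < 1" by (auto simp: eventually_sequentially)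
    \<comment> \<open>An odd index beyond \<open>N\<close>: the denominator then has even length
      \<open>?m + 1\<close>, and the numerator adds one uniform coordinate, so the quotient is
      1.\<close>
    let ?m = "Suc (2 * N)"
    have r: "restrict (restrict (y(Suc ?m := x)) {..<?m + 2}) {..<?m + 1} = restrict y {..<?m + 1}"
      by (auto simp: fun_eq_iff)
    have "f (?m + 2) (restrict (y(Suc ?m := x)) {..<?m + 2}) = g (?m + 1) (restrict y {..<?m + 1})"
      using x by (simp add: f_def r[simplified])
    moreover have "f (?m + 1) (restrict y {..<?m + 1}) = g (?m + 1) (restrict y {..<?m + 1})"
      by (simp add: f_def)
    ultimately have "?q ?m = 1" using y[rule_format, of "?m + 1"] by simp
    then show False using N[of ?m] by simp
  qed
  have div: "AE x in lborel. x \<in> {0<..<1} \<longrightarrow> (AE y in \<nu>. \<not> summable (\<lambda>m.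
      f (m + 2) (restrict (y(Suc m := x)) {..<m + 2}) / f (m + 1) (restrict y {..<m + 1})))"
  proof (rule AE_I2, rule impI)
    fix x :: real assume x: "x \<in> {0<..<1}"
    show "AE y in \<nu>. \<not> summable (\<lambda>m.
      f (m + 2) (restrict (y(Suc m := x)) {..<m + 2}) / f (m + 1) (restrict y {..<m + 1}))"
      using pos
    proof eventually_elim
      case (elim y)
      show ?case by (rule diverges[OF elim x])
    qed
  qed
  have "0 \<le> f n z" for n z by (simp add: f_def g(2))
  then have dens: "\<forall>n\<ge>1. f n \<in> borel_measurable (lebesgue_tuples n) \<and> (\<forall>z. 0 \<le> f n z) \<and>
      distr \<nu> (lebesgue_tuples n) (\<lambda>y. restrict y {..<n}) = density (lebesgue_tuples n) (\<lambda>z. ennreal (f n z))"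
    using f f_law by blast
  show ?thesis
    unfolding uniform_distribution_def S_def[symmetric]
    by (rule exI[of _ \<nu>], intro conjI p\<nu> s\<nu> in01 coupled exI[of _ f] dens div)
qed

section \<open>Hitting sets of positive measure\<close>

lemma hits_uniformly_seq_law_iff:
  assumes "random_countable_subset M X"
  shows "hits_uniformly (seq_law M X) \<longleftrightarrow>
    (\<forall>B\<in>sets borel. B \<subseteq> {0<..<1} \<longrightarrow>
       (measure lborel B = 0 \<longrightarrow> measure M {\<omega>\<in>space M. B \<inter> range (\<lambda>k. X k \<omega>) \<noteq> {}} = 0) \<and>
       (measure lborel B > 0 \<longrightarrow> measure M {\<omega>\<in>space M. B \<inter> range (\<lambda>k. X k \<omega>) \<noteq> {}} = 1))"
    (is "_ \<longleftrightarrow> ?R")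
proof -
  interpret prob_space M using assms by (simp add: random_countable_subset_def)
  have Xm [measurable]: "X k \<in> borel_measurable M" for k using assms by (simp add: random_countable_subset_def)
  have X01: "X k \<omega> \<in> {0<..<1}" if "\<omega> \<in> space M" for k \<omega>
    using assms that by (simp add: random_countable_subset_def)
  let ?E = "\<lambda>B. {\<omega>\<in>space M. B \<inter> range (\<lambda>k. X k \<omega>) \<noteq> {}}"
  have E_eq: "?E B = {\<omega>\<in>space M. \<exists>k. X k \<omega> \<in> B}" for B by auto
  have E_sets: "?E B \<in> events" if [measurable]: "B \<in> sets borel" for B unfolding E_eq by measurable
  have lawm: "(\<lambda>\<omega> k. X k \<omega>) \<in> measurable M real_seqs" by (rule measurable_PiM_single') auto
  have hits: "hits_uniformly (seq_law M X) \<longleftrightarrow>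
      (\<forall>B\<in>sets borel. if emeasure unit_uniform B = 0 then prob (?E B) = 0 else prob (?E B) = 1)"
    unfolding hits_uniformly_def
  proof (rule ball_cong[OF refl])
    fix B :: "real set" assume B [measurable]: "B \<in> sets borel"
    have m: "{x \<in> space real_seqs. emeasure unit_uniform B \<noteq> 0 \<longleftrightarrow> (\<exists>k. x k \<in> B)} \<in> sets real_seqs"
    proof -
      have "Measurable.pred real_seqs (\<lambda>x. emeasure unit_uniform B \<noteq> 0 \<longleftrightarrow> (\<exists>k. x k \<in> B))"
        by (rule pred_intros_logic(6)) measurable
      then show ?thesis by (simp add: pred_def)
    qed
    have "(AE x in seq_law M X. emeasure unit_uniform B \<noteq> 0 \<longleftrightarrow> (\<exists>k. x k \<in> B)) \<longleftrightarrow>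
        (AE \<omega> in M. emeasure unit_uniform B \<noteq> 0 \<longleftrightarrow> (\<exists>k. X k \<omega> \<in> B))"
      unfolding seq_law_def by (rule AE_distr_iff[OF lawm m])
    also have "\<dots> \<longleftrightarrow> (AE \<omega> in M. emeasure unit_uniform B \<noteq> 0 \<longleftrightarrow> \<omega> \<in> ?E B)"
      by (rule AE_cong) (auto simp: E_eq)
    also have "\<dots> \<longleftrightarrow> (if emeasure unit_uniform B = 0 then prob (?E B) = 0 else prob (?E B) = 1)"
      using prob_eq_0[OF E_sets[OF B]] prob_eq_1[OF E_sets[OF B]] by (cases "emeasure unit_uniform B = 0") simp_all
    finally show "(AE x in seq_law M X. emeasure unit_uniform B \<noteq> 0 \<longleftrightarrow> (\<exists>k. x k \<in> B)) \<longleftrightarrow>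
        (if emeasure unit_uniform B = 0 then prob (?E B) = 0 else prob (?E B) = 1)" .
  qed
  \<comment> \<open>The real-valued \<open>measure\<close> would be 0 also on sets of infinite
    measure; intersecting with the unit interval rules this out.\<close>
  have unif: "emeasure unit_uniform B = 0 \<longleftrightarrow> measure lborel (B \<inter> {0<..<1}) = 0" if [measurable]: "B \<in> sets borel" for B
  proof -
    have "emeasure unit_uniform B = emeasure lborel (B \<inter> {0<..<1})"
      by (subst emeasure_uniform_measure) (auto simp: divide_ennreal_def Int_commute)
    moreover have "emeasure lborel (B \<inter> {0<..<1}) \<le> emeasure lborel {0<..<1::real}" by (intro emeasure_mono) auto
    then have "emeasure lborel (B \<inter> {0<..<1}) < top" by (auto intro: le_less_trans)
    ultimately show ?thesis by (auto simp: measure_def enn2real_eq_0_iff)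
  qed
  \<comment> \<open>All points lie in the unit interval, so a general Borel set may be replaced by
    its part there.\<close>
  have Eint: "?E (B \<inter> {0<..<1}) = ?E B" for B using X01 by (auto simp: E_eq)
  show ?thesis
    unfolding hits
  proof (intro iffI ballI impI)
    fix B :: "real set" assume *: "\<forall>B\<in>sets borel. if emeasure unit_uniform B = 0 then prob (?E B) = 0 else prob (?E B) = 1"
      and B: "B \<in> sets borel" "B \<subseteq> {0<..<1}"
    have "B \<inter> {0<..<1} = B" using B(2) by auto
    then show "(measure lborel B = 0 \<longrightarrow> prob (?E B) = 0) \<and> (measure lborel B > 0 \<longrightarrow> prob (?E B) = 1)"
      using bspec[OF * B(1)] unif[OF B(1)] by (simp split: if_splits)
  next
    fix B :: "real set" assume *: ?R and B: "B \<in> sets borel"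
    have "B \<inter> {0<..<1} \<in> sets borel" "B \<inter> {0<..<1} \<subseteq> {0<..<1}" using B by auto
    from bspec[OF * this(1), THEN mp, OF this(2)]
    show "if emeasure unit_uniform B = 0 then prob (?E B) = 0 else prob (?E B) = 1"
      unfolding Eint unif[OF B] by (simp add: zero_less_measure_iff)
  qed
qed

text \<open>The quotients \<open>f (m + 2) / f (m + 1)\<close> are conditional densities of the next point; on the event
  that no point lies in \<open>B\<close>, the divergence of their sum would make the expected number of first
  visits to \<open>B\<close> infinite.\<close>

lemma divergent_conditional_densities_hit:
  fixes \<nu> :: "(nat \<Rightarrow> real) measure" and f :: "nat \<Rightarrow> (nat \<Rightarrow> real) \<Rightarrow> real"
  assumes \<nu>: "prob_space \<nu>" "sets \<nu> = sets real_seqs"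
    and f: "\<And>n. n \<ge> 1 \<Longrightarrow> f n \<in> borel_measurable (lebesgue_tuples n)" "\<And>n z. n \<ge> 1 \<Longrightarrow> 0 \<le> f n z"
    and law: "\<And>n. n \<ge> 1 \<Longrightarrow> distr \<nu> (lebesgue_tuples n) (\<lambda>y. restrict y {..<n}) =
      density (lebesgue_tuples n) (\<lambda>z. ennreal (f n z))"
    and div: "AE x in lborel. x \<in> B \<longrightarrow> (AE y in \<nu>. \<not> summable (\<lambda>m.
      f (m + 2) (restrict (y(Suc m := x)) {..<m + 2}) / f (m + 1) (restrict y {..<m + 1})))"
    and B: "B \<in> sets borel" "emeasure lborel B \<noteq> 0"
  shows "AE y in \<nu>. \<exists>k. y k \<in> B"
proof -
  interpret prob_space \<nu> by fact
  interpret L: product_sigma_finite "\<lambda>_::nat. lborel :: real measure" ..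
  note [measurable_cong] = \<nu>(2) sets_lebesgue_tuples and [measurable] = B(1) measurable_snoc
  have fm [measurable]: "f (Suc n) \<in> borel_measurable (real_tuples (Suc n))" for n
    using f(1)[of "Suc n"] by measurable
  have restr: "(\<lambda>y. restrict y {..<n}) \<in> measurable \<nu> (real_tuples n)" for n by measurable
  define A where "A m = {z \<in> space (real_tuples (Suc m)). \<forall>i<Suc m. z i \<notin> B}" for m
  have A [measurable]: "A m \<in> sets (real_tuples (Suc m))" for m
  proof -
    have "Measurable.pred (real_tuples (Suc m)) (\<lambda>z. z i \<notin> B)" if "i \<in> {..<Suc m}" for i
      using measurable_component_singleton[OF that, of "\<lambda>_. borel"] by measurable
    then have "Measurable.pred (real_tuples (Suc m)) (\<lambda>z. \<forall>i\<in>{..<Suc m}. z i \<notin> B)"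
      by (intro pred_intros_finite) auto
    then show ?thesis by (simp add: A_def pred_def Ball_def)
  qed
  define miss where "miss = {y \<in> space \<nu>. \<forall>k. y k \<notin> B}"
  \<comment> \<open>A first visit at index \<open>Suc m\<close>. A visit at index 0 is left out
    because the series starts with the conditional density of the second point; disjointness still
    bounds the total probability by 1.\<close>
  define first where "first m = {y \<in> space \<nu>. (\<forall>i<Suc m. y i \<notin> B) \<and> y (Suc m) \<in> B}" for m
  have comp [measurable]: "(\<lambda>y. y k) \<in> borel_measurable \<nu>" for k by measurable
  have miss: "miss \<in> events" and first: "first m \<in> events" for m
    unfolding miss_def first_def by measurable
  \<comment> \<open>The density at \<open>x\<close> of the event \<open>first m\<close> with respect
    to the location of the visit.\<close>
  define I where "I m x = (\<integral>\<^sup>+z. indicator (A m) z * indicator B x * ennreal (f (Suc (Suc m)) (z(Suc m := x)))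
     \<partial>lebesgue_tuples (Suc m))" for m x
  have sf: "sigma_finite_measure (lebesgue_tuples n)" for n by (rule L.sigma_finite) simp
  have joint: "(\<lambda>(x, z). indicator (A m) z * indicator B x * ennreal (f (Suc (Suc m)) (z(Suc m := x))))
      \<in> borel_measurable (borel \<Otimes>\<^sub>M lebesgue_tuples (Suc m))" for m
  proof -
    have "(\<lambda>p. (snd p)(Suc m := fst p)) \<in> measurable (borel \<Otimes>\<^sub>M real_tuples (Suc m)) (real_tuples (Suc (Suc m)))"
      by (rule measurable_fun_upd[where J = "{..<Suc m}"]) auto
    note measurable_compose[OF this fm, measurable]
    show ?thesis unfolding split_beta' by measurable
  qed
  have I [measurable]: "I m \<in> borel_measurable borel" for m
    unfolding I_def using sigma_finite_measure.borel_measurable_nn_integral[OF sf joint[of m]] by simp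
  \<comment> \<open>The integral over \<open>x\<close> is outermost because divergence is assumed
    for almost every fixed \<open>x\<close>.\<close>
  have I_first: "(\<integral>\<^sup>+x. I m x \<partial>lborel) = emeasure \<nu> (first m)" for m
  proof -
    let ?n = "Suc (Suc m)"
    let ?G = "\<lambda>z. indicator (A m) (restrict z {..<Suc m}) * indicator B (z (Suc m)) :: ennreal"
    have [measurable]: "(\<lambda>z. z (Suc m)) \<in> borel_measurable (real_tuples ?n)"
      by (rule measurable_component_singleton) simp
    have [measurable]: "(\<lambda>z. restrict z {..<Suc m}) \<in> measurable (real_tuples ?n) (real_tuples (Suc m))"
      by (rule measurable_restrict_subset) auto
    have G [measurable]: "?G \<in> borel_measurable (real_tuples ?n)" by measurable
    have "emeasure \<nu> (first m) = (\<integral>\<^sup>+y. indicator (first m) y \<partial>\<nu>)" using first by simp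
    also have "\<dots> = (\<integral>\<^sup>+y. ?G (restrict y {..<?n}) \<partial>\<nu>)"
    proof (rule nn_integral_cong)
      fix y assume "y \<in> space \<nu>"
      moreover have "restrict (restrict y {..<?n}) {..<Suc m} = restrict y {..<Suc m}" by (auto simp: fun_eq_iff)
      ultimately show "indicator (first m) y = ?G (restrict y {..<?n})"
        by (auto simp: first_def A_def indicator_def space_PiM)
    qed
    also have "\<dots> = (\<integral>\<^sup>+z. ?G z \<partial>distr \<nu> (lebesgue_tuples ?n) (\<lambda>y. restrict y {..<?n}))"
      by (rule nn_integral_distr[symmetric]) measurable
    also have "\<dots> = (\<integral>\<^sup>+z. ennreal (f ?n z) * ?G z \<partial>lebesgue_tuples ?n)"
      by (subst law, simp, rule nn_integral_density) measurable
    also have "\<dots> = (\<integral>\<^sup>+x. \<integral>\<^sup>+z. ennreal (f ?n (z(Suc m := x))) * ?G (z(Suc m := x)) \<partial>lebesgue_tuples (Suc m) \<partial>lborel)"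
    proof -
      have "(\<lambda>z. ennreal (f ?n z) * ?G z) \<in> borel_measurable (PiM (insert (Suc m) {..<Suc m}) (\<lambda>_. lborel))"
        unfolding lessThan_Suc[symmetric] by measurable
      from L.product_nn_integral_insert_rev[OF _ _ this] show ?thesis by (simp add: lessThan_Suc[of "Suc m"])
    qed
    also have "\<dots> = (\<integral>\<^sup>+x. I m x \<partial>lborel)"
      unfolding I_def
    proof (intro nn_integral_cong)
      fix x :: real and z :: "nat \<Rightarrow> real" assume "z \<in> space (lebesgue_tuples (Suc m))"
      then have "restrict (z(Suc m := x)) {..<Suc m} = z"
        by (auto simp: space_PiM PiE_iff fun_eq_iff extensional_def)
      then show "ennreal (f ?n (z(Suc m := x))) * ?G (z(Suc m := x)) =
          indicator (A m) z * indicator B x * ennreal (f (Suc (Suc m)) (z(Suc m := x)))"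
        by (simp add: mult_ac)
    qed
    finally show ?thesis ..
  qed
  have "disjoint_family first"
  proof -
    have "first m \<inter> first n = {}" if "m < n" for m n using that by (auto simp: first_def)
    then have "first m \<inter> first n = {}" if "m \<noteq> n" for m n
      using that by (metis Int_commute linorder_neqE_nat)
    then show ?thesis by (auto simp: disjoint_family_on_def)
  qed
  then have "(\<Sum>m. emeasure \<nu> (first m)) = emeasure \<nu> (\<Union>m. first m)"
    using first by (intro suminf_emeasure) auto
  also have "\<dots> \<le> 1" by (rule emeasure_le_1)
  finally have sum_le: "(\<integral>\<^sup>+x. (\<Sum>m. I m x) \<partial>lborel) \<le> 1"
    by (simp add: nn_integral_suminf I_first)
  \<comment> \<open>On \<open>miss\<close> none of the indicators of \<open>A m\<close> cuts off a
    term, so the divergent series is integrated in full there; off \<open>miss\<close> the bound is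
    trivial.\<close>
  have "AE x in lborel. top * emeasure \<nu> miss * indicator B x \<le> (\<Sum>m. I m x)"
    using div
  proof eventually_elim
    case (elim x)
    show ?case
    proof (cases "x \<in> B")
      case True
      define q where "q m y = f (Suc (Suc m)) ((restrict y {..<Suc m})(Suc m := x)) / f (Suc m) (restrict y {..<Suc m})"
        for m and y :: "nat \<Rightarrow> real"
      have upd: "restrict (y(Suc m := x)) {..<m + 2} = (restrict y {..<Suc m})(Suc m := x)" for y m
        by (auto simp: fun_eq_iff)
      have q0: "0 \<le> q m y" for m y unfolding q_def by (intro divide_nonneg_nonneg f(2)) auto
      have [measurable]: "(\<lambda>z. z(Suc m := x)) \<in> measurable (real_tuples (Suc m)) (real_tuples (Suc (Suc m)))" for m
        by (rule measurable_fun_upd[where J = "{..<Suc m}"]) auto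
      have restr' [measurable]: "(\<lambda>y. restrict y {..<Suc m}) \<in> measurable \<nu> (real_tuples (Suc m))" for m
        by (rule restr)
      have [measurable]: "(\<lambda>y. f (Suc (Suc m)) ((restrict y {..<Suc m})(Suc m := x))) \<in> borel_measurable \<nu>" for m
        by (rule measurable_compose[OF restr']) measurable
      have qm [measurable]: "q m \<in> borel_measurable \<nu>" for m unfolding q_def by measurable
      have "AE y in \<nu>. \<not> summable (\<lambda>m. q m y)"
        using elim True by (simp add: q_def upd[simplified])
      then have "AE y in \<nu>. top * indicator miss y \<le>
          (\<Sum>m. indicator (A m) (restrict y {..<Suc m}) * ennreal (q m y))"
        using AE_space
      proof eventually_elim
        case (elim y)
        show ?case
        proof (cases "y \<in> miss")
          case True
          then have "restrict y {..<Suc m} \<in> A m" for m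
            by (auto simp: miss_def A_def space_PiM)
          moreover have "(\<Sum>m. ennreal (q m y)) = top"
            using elim(1) summable_suminf_not_top[of "\<lambda>m. q m y"] q0 by blast
          ultimately show ?thesis by simp
        qed simp
      qed
      then have "(\<integral>\<^sup>+y. top * indicator miss y \<partial>\<nu>) \<le>
          (\<integral>\<^sup>+y. (\<Sum>m. indicator (A m) (restrict y {..<Suc m}) * ennreal (q m y)) \<partial>\<nu>)"
        by (rule nn_integral_mono_AE)
      also have "\<dots> = (\<Sum>m. \<integral>\<^sup>+y. indicator (A m) (restrict y {..<Suc m}) * ennreal (q m y) \<partial>\<nu>)"
        by (rule nn_integral_suminf) measurable
      also have "\<dots> \<le> (\<Sum>m. I m x)"
      proof (intro suminf_le)
        fix m
        let ?Q = "\<lambda>z. indicator (A m) z * ennreal (f (Suc (Suc m)) (z(Suc m := x)) / f (Suc m) z)"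
        have "(\<integral>\<^sup>+y. indicator (A m) (restrict y {..<Suc m}) * ennreal (q m y) \<partial>\<nu>) =
            (\<integral>\<^sup>+z. ?Q z \<partial>distr \<nu> (lebesgue_tuples (Suc m)) (\<lambda>y. restrict y {..<Suc m}))"
          unfolding q_def by (rule nn_integral_distr[symmetric]) measurable
        also have "\<dots> = (\<integral>\<^sup>+z. ennreal (f (Suc m) z) * ?Q z \<partial>lebesgue_tuples (Suc m))"
          by (subst law, simp, rule nn_integral_density) measurable
        also have "\<dots> \<le> I m x"
          unfolding I_def
        proof (rule nn_integral_mono)
          fix z :: "nat \<Rightarrow> real"
          have pos: "0 \<le> f (Suc m) z" "0 \<le> f (Suc (Suc m)) (z(Suc m := x))" by (auto intro: f(2))
          \<comment> \<open>Only an inequality: where the denominator vanishes, the quotient is 0 by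
            convention, whereas the numerator may be positive.\<close>
          have "f (Suc m) z * (f (Suc (Suc m)) (z(Suc m := x)) / f (Suc m) z) \<le> f (Suc (Suc m)) (z(Suc m := x))"
            using pos by (cases "f (Suc m) z = 0") auto
          then have "ennreal (f (Suc m) z) * ennreal (f (Suc (Suc m)) (z(Suc m := x)) / f (Suc m) z)
              \<le> ennreal (f (Suc (Suc m)) (z(Suc m := x)))"
            using pos by (simp add: ennreal_mult[symmetric])
          then show "ennreal (f (Suc m) z) * ?Q z
              \<le> indicator (A m) z * indicator B x * ennreal (f (Suc (Suc m)) (z(Suc m := x)))"
            using True by (auto simp: indicator_def)
        qed
        finally show "(\<integral>\<^sup>+y. indicator (A m) (restrict y {..<Suc m}) * ennreal (q m y) \<partial>\<nu>) \<le> I m x" .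
      qed auto
      finally show ?thesis using True miss by (simp add: nn_integral_cmult_indicator)
    qed simp
  qed
  then have "(\<integral>\<^sup>+x. top * emeasure \<nu> miss * indicator B x \<partial>lborel) \<le> (\<integral>\<^sup>+x. (\<Sum>m. I m x) \<partial>lborel)"
    by (rule nn_integral_mono_AE)
  also have "\<dots> \<le> 1" by (rule sum_le)
  finally have le: "top * emeasure \<nu> miss * emeasure lborel B \<le> 1"
    using B(1) by (simp add: nn_integral_cmult_indicator)
  have "emeasure \<nu> miss = 0"
  proof (rule ccontr)
    assume "emeasure \<nu> miss \<noteq> 0"
    \<comment> \<open>If \<open>miss\<close> and \<open>B\<close> both had positive measure, the
      expected number of first visits would be infinite.\<close>
    then have "top * emeasure \<nu> miss * emeasure lborel B = top"
      using B(2) by (simp add: ennreal_top_mult)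
    with le show False by (simp add: top_unique)
  qed
  then show ?thesis
    using miss by (subst AE_iff_measurable[OF _ refl]) (auto simp: miss_def)
qed

text \<open>For sets of positive measure the divergent series gives the hit. A null set is missed
  because each single coordinate of \<open>\<nu>\<close> has an absolutely continuous law. The
  coupling then moves both facts from \<open>\<nu>\<close> to the law of \<open>X\<close>.\<close>

lemma hits_uniformly_if_uniform_distribution:
  assumes X: "random_countable_subset M X" and unif: "uniform_distribution M X"
  shows "hits_uniformly (seq_law M X)"
proof -
  interpret M: prob_space M using X by (simp add: random_countable_subset_def)
  have [measurable]: "X k \<in> borel_measurable M" for k using X by (simp add: random_countable_subset_def)
  define S where "S = seq_law M X"
  have S: "prob_space S" "sets S = sets real_seqs"
    unfolding S_def by (auto simp: seq_law_def intro!: M.prob_space_distr measurable_PiM_single')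
  obtain \<nu> f where \<nu>: "prob_space \<nu>" "sets \<nu> = sets real_seqs" "AE y in \<nu>. \<forall>k. y k \<in> {0<..<1}"
    and coup: "coupled_sets S range \<nu> range"
    and f: "\<forall>n\<ge>1. f n \<in> borel_measurable (lebesgue_tuples n) \<and> (\<forall>z. 0 \<le> f n z) \<and>
      distr \<nu> (lebesgue_tuples n) (\<lambda>y. restrict y {..<n}) = density (lebesgue_tuples n) (\<lambda>z. ennreal (f n z))"
    and div: "AE x in lborel. x \<in> {0<..<1} \<longrightarrow> (AE y in \<nu>. \<not> summable (\<lambda>m.
      f (m + 2) (restrict (y(Suc m := x)) {..<m + 2}) / f (m + 1) (restrict y {..<m + 1})))"
    using unif unfolding uniform_distribution_def S_def by blast
  obtain P where P: "prob_space P" "sets P = sets (S \<Otimes>\<^sub>M \<nu>)" "distr P S fst = S" "distr P \<nu> snd = \<nu>"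
    "AE p in P. range (fst p) = range (snd p)"
    using coup unfolding coupled_sets_def by blast
  have mfst: "fst \<in> measurable P S" and msnd: "snd \<in> measurable P \<nu>"
    using measurable_cong_sets[OF P(2) refl] by auto
  interpret \<nu>: prob_space \<nu> by fact
  show ?thesis
    unfolding hits_uniformly_def S_def[symmetric]
  proof
    fix B :: "real set" assume B: "B \<in> sets borel"
    define B' where "B' = B \<inter> {0<..<1}"
    have B' [measurable]: "B' \<in> sets borel" unfolding B'_def using B by auto
    have UB: "emeasure unit_uniform B = emeasure lborel B'"
      using B by (subst emeasure_uniform_measure) (auto simp: divide_ennreal_def B'_def Int_commute)
    have "AE y in \<nu>. emeasure unit_uniform B \<noteq> 0 \<longleftrightarrow> (\<exists>k. y k \<in> B')"
    proof (cases "emeasure unit_uniform B = 0")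
      case False
      have "AE x in lborel. x \<in> B' \<longrightarrow> (AE y in \<nu>. \<not> summable (\<lambda>m.
          f (m + 2) (restrict (y(Suc m := x)) {..<m + 2}) / f (m + 1) (restrict y {..<m + 1})))"
        using div by eventually_elim (auto simp: B'_def)
      then have "AE y in \<nu>. \<exists>k. y k \<in> B'"
        using f False UB by (intro divergent_conditional_densities_hit[OF \<nu>(1,2) _ _ _ _ B']) auto
      with False show ?thesis by simp
    next
      case True
      have "AE y in \<nu>. y k \<notin> B'" for k
      proof -
        have [measurable]: "(\<lambda>z. z k) \<in> borel_measurable (real_tuples (Suc k))"
          by (rule measurable_component_singleton) simp
        have m: "(\<lambda>z. indicator B' (z k) :: ennreal) \<in> borel_measurable (real_tuples (Suc k))" by measurable
        then have m': "(\<lambda>z. indicator B' (z k) :: ennreal) \<in> borel_measurable (lebesgue_tuples (Suc k))"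
          using measurable_cong_sets[OF sets_lebesgue_tuples refl] by blast
        \<comment> \<open>Coordinate \<open>k\<close> is the last one of a tuple of length
          \<open>Suc k\<close>, so integrating it first already gives 0.\<close>
        have "(\<integral>\<^sup>+z. indicator B' (z k) \<partial>lebesgue_tuples (Suc k)) = 0"
          unfolding nn_integral_lebesgue_tuples_Suc[OF m] using True B' UB by simp
        then have "AE z in lebesgue_tuples (Suc k). z k \<notin> B'"
          by (subst (asm) nn_integral_0_iff_AE[OF m']) (auto simp: indicator_def split: if_splits elim: eventually_mono)
        moreover have "f (Suc k) \<in> borel_measurable (lebesgue_tuples (Suc k))" using f by simp
        ultimately have "AE z in density (lebesgue_tuples (Suc k)) (\<lambda>z. ennreal (f (Suc k) z)). z k \<notin> B'"
          by (subst AE_density) (auto elim: eventually_mono)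
        moreover have "1 \<le> Suc k" by simp
        then have "distr \<nu> (lebesgue_tuples (Suc k)) (\<lambda>y. restrict y {..<Suc k}) =
            density (lebesgue_tuples (Suc k)) (\<lambda>z. ennreal (f (Suc k) z))"
          using f by blast
        ultimately have "AE z in distr \<nu> (lebesgue_tuples (Suc k)) (\<lambda>y. restrict y {..<Suc k}). z k \<notin> B'"
          by (simp only:)
        moreover have "(\<lambda>y. restrict y {..<Suc k}) \<in> measurable \<nu> (lebesgue_tuples (Suc k))"
          unfolding measurable_cong_sets[OF \<nu>(2) refl] by (rule measurable_restrict) simp
        ultimately have "AE y in \<nu>. restrict y {..<Suc k} k \<notin> B'" by (rule AE_distrD[rotated])
        then show ?thesis by simp
      qed
      then have "AE y in \<nu>. \<forall>k. y k \<notin> B'" by (subst AE_all_countable) simp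
      then show ?thesis by eventually_elim (use True in simp)
    qed
    then have hit: "AE y in \<nu>. emeasure unit_uniform B \<noteq> 0 \<longleftrightarrow> (\<exists>k. y k \<in> B)"
      using \<nu>(3) by eventually_elim (auto simp: B'_def)
    show "AE x in S. emeasure unit_uniform B \<noteq> 0 \<longleftrightarrow> (\<exists>k. x k \<in> B)"
    proof (rule AE_to_marginal[OF P(3) mfst])
      have "Measurable.pred real_seqs (\<lambda>x. emeasure unit_uniform B \<noteq> 0 \<longleftrightarrow> (\<exists>k. x k \<in> B))"
        by (rule pred_intros_logic(6)) (use B in measurable)
      then show "Measurable.pred S (\<lambda>x. emeasure unit_uniform B \<noteq> 0 \<longleftrightarrow> (\<exists>k. x k \<in> B))"
        unfolding measurable_cong_sets[OF S(2) refl] .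
      show "AE p in P. emeasure unit_uniform B \<noteq> 0 \<longleftrightarrow> (\<exists>k. fst p k \<in> B)"
        using P(5) AE_from_marginal[OF P(4) msnd hit]
      proof eventually_elim
        case (elim p)
        have "(\<exists>k. fst p k \<in> B) \<longleftrightarrow> (\<exists>k. snd p k \<in> B)"
          using elim(1) by (metis rangeE rangeI)
        with elim(2) show ?case by simp
      qed
    qed
  qed
qed

theorem theorem6p1:
  fixes M :: "'a measure" and X :: "nat \<Rightarrow> 'a \<Rightarrow> real"
  assumes "random_dense_countable_subset M X"
    and "independence_condition M X"
  shows "uniform_distribution M X \<longleftrightarrow>
    (\<forall>B\<in>sets borel. B \<subseteq> {0<..<1} \<longrightarrow>
       (measure lborel B = 0 \<longrightarrow> measure M {\<omega>\<in>space M. B \<inter> range (\<lambda>k. X k \<omega>) \<noteq> {}} = 0) \<and>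
       (measure lborel B > 0 \<longrightarrow> measure M {\<omega>\<in>space M. B \<inter> range (\<lambda>k. X k \<omega>) \<noteq> {}} = 1))"
proof -
  have X: "random_countable_subset M X" using assms(1) by (simp add: random_dense_countable_subset_def)
  have "uniform_distribution M X \<longleftrightarrow> hits_uniformly (seq_law M X)"
    using hits_uniformly_if_uniform_distribution[OF X]
      uniform_distribution_if_saturated[OF X saturated_seq_law[OF X assms(2)]] by blast
  then show ?thesis unfolding hits_uniformly_seq_law_iff[OF X] .
qed



end
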